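(* For $i=1,2$ let $R_i$ be a unital ring whose additive group is finitely generated and torsion-free, $M_i\subseteq R_i^\times$ an abelian submonoid such that ${\rm span}_{\mathbb Z}(M_i)$ has finite index in $R_i$, and $\mathcal L_i\subseteq R_i$ a full rank subgroup invariant under left multiplication by $M_i$. Assume that there is $a\in M_1$ such that $x\mapsto(1-a)x$ is injective on $\mathcal L_1$, and similarly there is $a'\in M_2$ such that $x\mapsto(1-a')x$ is injective on $\mathcal L_2$. If the topological groupoids $(M_1^{-1}\mathcal L_1\rtimes\langle M_1\rangle)\ltimes\overline{\mathcal L_1}$ and $(M_2^{-1}\mathcal L_2\rtimes\langle M_2\rangle)\ltimes\overline{\mathcal L_2}$ are isomorphic, then there are $\mathbb Q$-algebra isomorphisms $\varphi_1\colon\mathbb QR_1\to\mathbb QR_2$ and $\varphi_2\colon\mathbb QR_2\to\mathbb QR_1$ with $\varphi_1(M_1)\subseteq\widetilde{M_2}$ and $\varphi_2(M_2)\subseteq\widetilde{M_1}$.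
   Context: $\mathbb QR=\mathbb Q\otimes_{\mathbb Z}R$; $R^\times$ is the monoid of left regular elements; $\langle M\rangle$ is the subgroup of $(\mathbb QR)^*$ generated by $M$; full rank means ${\rm rk}\,\mathcal L={\rm rk}\,R$; $M^{-1}\mathcal L=\bigcup_{a\in M}a^{-1}\mathcal L\subseteq\mathbb QR$. $\mathcal O$ is the set of elements of $\mathbb QR$ integral over $\mathbb Z$, and $\widetilde M=\langle M\rangle\cap\mathcal O$. The constructible subgroups of $M\curvearrowright\mathcal L$ form the smallest family of subgroups of $\mathcal L$ containing $\mathcal L$ and closed under $C\mapsto aC$ and $C\mapsto\{x\in\mathcal L:ax\in C\}$ ($a\in M$); they have finite index and $\overline{\mathcal L}=\varprojlim_C\mathcal L/C$. The group $M^{-1}\mathcal L\rtimes\langle M\rangle$ acts on $M^{-1}\mathcal L$ by $(b,u).x=b+ux$; its restriction to $\mathcal L$ is a partial action that extends uniquely to a partial action on $\overline{\mathcal L}$ by homeomorphisms between open sets, and the groupoid is its partial transformation groupoid. *)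

theory Defs
  imports "HOL-Analysis.Analysis"
begin

section \<open>Algebraic preliminaries (inside an ambient ring playing the role of QR)\<close>

definition zspan :: "'a::ring_1 set \<Rightarrow> 'a set" where
  "zspan S = {x. \<exists>F c. finite F \<and> F \<subseteq> S \<and> x = (\<Sum>s\<in>F. of_int (c s) * s)}"

definition zindep :: "'a::ring_1 set \<Rightarrow> bool" where
  "zindep S \<longleftrightarrow> (\<forall>F c. finite F \<and> F \<subseteq> S \<and> (\<Sum>s\<in>F. of_int (c s) * s) = 0
                       \<longrightarrow> (\<forall>s\<in>F. c s = 0))"

definition zrank :: "'a::ring_1 set \<Rightarrow> nat" where
  "zrank G = Sup {card S | S. finite S \<and> S \<subseteq> G \<and> zindep S}"

definition add_subgroup :: "'a::ring_1 set \<Rightarrow> bool" where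
  "add_subgroup G \<longleftrightarrow> 0 \<in> G \<and> (\<forall>x\<in>G. - x \<in> G) \<and> (\<forall>x\<in>G. \<forall>y\<in>G. x + y \<in> G)"

definition unital_subring :: "'a::ring_1 set \<Rightarrow> bool" where
  "unital_subring R \<longleftrightarrow> add_subgroup R \<and> 1 \<in> R \<and> (\<forall>x\<in>R. \<forall>y\<in>R. x * y \<in> R)"

definition fin_gen :: "'a::ring_1 set \<Rightarrow> bool" where
  "fin_gen G \<longleftrightarrow> (\<exists>S. finite S \<and> S \<subseteq> G \<and> zspan S = G)"

text \<open>The ambient ring (the whole type) is QR = Q \<otimes> R: every positive integer is
  invertible (so the ambient ring is a Q-algebra and R is torsion-free), and every
  element is of the form r/n with r in R.\<close>
definition is_QR :: "'a::ring_1 set \<Rightarrow> bool" where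
  "is_QR R \<longleftrightarrow> (\<forall>n::nat. n > 0 \<longrightarrow> (\<exists>y::'a. of_nat n * y = 1 \<and> y * of_nat n = 1))
             \<and> (\<forall>x::'a. \<exists>r\<in>R. \<exists>n::nat. n > 0 \<and> of_nat n * x = r)"

definition left_regular :: "'a::ring_1 set \<Rightarrow> 'a \<Rightarrow> bool" where
  "left_regular R a \<longleftrightarrow> a \<in> R \<and> (\<forall>x\<in>R. a * x = 0 \<longrightarrow> x = 0)"

definition abelian_submonoid_regular :: "'a::ring_1 set \<Rightarrow> 'a set \<Rightarrow> bool" where
  "abelian_submonoid_regular R M \<longleftrightarrow> M \<subseteq> {a. left_regular R a} \<and> 1 \<in> M
      \<and> (\<forall>a\<in>M. \<forall>b\<in>M. a * b \<in> M \<and> a * b = b * a)"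

definition finite_index :: "'a::ring_1 set \<Rightarrow> 'a set \<Rightarrow> bool" where
  "finite_index H G \<longleftrightarrow> finite ((\<lambda>x. (\<lambda>h. x + h) ` H) ` G)"

definition qunit :: "'a::ring_1 \<Rightarrow> bool" where
  "qunit x \<longleftrightarrow> (\<exists>y. x * y = 1 \<and> y * x = 1)"

definition qinv :: "'a::ring_1 \<Rightarrow> 'a" where
  "qinv x = (THE y. x * y = 1 \<and> y * x = 1)"

inductive_set grp_gen :: "'a::ring_1 set \<Rightarrow> 'a set" for M where
  one: "1 \<in> grp_gen M"
| gen: "a \<in> M \<Longrightarrow> a \<in> grp_gen M"
| inv: "a \<in> M \<Longrightarrow> qinv a \<in> grp_gen M"
| mult: "x \<in> grp_gen M \<Longrightarrow> y \<in> grp_gen M \<Longrightarrow> x * y \<in> grp_gen M"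

definition zintegral :: "'a::ring_1 \<Rightarrow> bool" where
  "zintegral x \<longleftrightarrow> (\<exists>n c. x ^ n + (\<Sum>i<n. of_int (c i) * x ^ i) = 0)"

definition Mtilde :: "'a::ring_1 set \<Rightarrow> 'a set" where
  "Mtilde M = grp_gen M \<inter> {x. zintegral x}"

definition MinvL :: "'a::ring_1 set \<Rightarrow> 'a set \<Rightarrow> 'a set" where
  "MinvL M L = {qinv a * x | a x. a \<in> M \<and> x \<in> L}"

text \<open>Q-algebra isomorphism between two Q-algebras (ring isomorphisms are automatically Q-linear).\<close>
definition qalg_iso :: "('a::ring_1 \<Rightarrow> 'b::ring_1) \<Rightarrow> bool" where
  "qalg_iso \<phi> \<longleftrightarrow> bij \<phi> \<and> \<phi> 1 = 1 \<and> (\<forall>x y. \<phi> (x + y) = \<phi> x + \<phi> y)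
                     \<and> (\<forall>x y. \<phi> (x * y) = \<phi> x * \<phi> y)"

inductive_set constructible :: "'a::ring_1 set \<Rightarrow> 'a set \<Rightarrow> 'a set set" for M L where
  base: "L \<in> constructible M L"
| mul: "C \<in> constructible M L \<Longrightarrow> a \<in> M \<Longrightarrow> (\<lambda>x. a * x) ` C \<in> constructible M L"
| pre: "C \<in> constructible M L \<Longrightarrow> a \<in> M \<Longrightarrow> {x\<in>L. a * x \<in> C} \<in> constructible M L"

definition cosets :: "'a::ring_1 set \<Rightarrow> 'a set \<Rightarrow> 'a set set" where
  "cosets L C = (\<lambda>x. (\<lambda>c. x + c) ` C) ` L"

text \<open>Lbar = inverse limit of the discrete groups L/C over constructible C (ordered by
  inclusion), with the inverse limit (subspace of product) topology.\<close>
definition Lbar_top :: "'a::ring_1 set \<Rightarrow> 'a set \<Rightarrow> ('a set \<Rightarrow> 'a set) topology" where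
  "Lbar_top M L = subtopology
     (product_topology (\<lambda>C. discrete_topology (cosets L C)) (constructible M L))
     {\<xi>. \<forall>C\<in>constructible M L. \<forall>D\<in>constructible M L. C \<subseteq> D \<longrightarrow> \<xi> C \<subseteq> \<xi> D}"

definition iota :: "'a::ring_1 set \<Rightarrow> 'a set \<Rightarrow> 'a \<Rightarrow> ('a set \<Rightarrow> 'a set)" where
  "iota M L x = restrict (\<lambda>C. (\<lambda>c. x + c) ` C) (constructible M L)"

text \<open>The group M^{-1}L \<rtimes> <M>, elements (b,u), acting by (b,u).x = b + u x.\<close>
definition grpG :: "'a::ring_1 set \<Rightarrow> 'a set \<Rightarrow> ('a \<times> 'a) set" where
  "grpG M L = MinvL M L \<times> grp_gen M"

definition act :: "'a::ring_1 \<times> 'a \<Rightarrow> 'a \<Rightarrow> 'a" where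
  "act g x = fst g + snd g * x"

definition dom0 :: "'a::ring_1 set \<Rightarrow> 'a \<times> 'a \<Rightarrow> 'a set" where
  "dom0 L g = {x\<in>L. act g x \<in> L}"

text \<open>Extension to Lbar: domain = closure of the image of dom0, map = continuous extension.\<close>
definition pdom :: "'a::ring_1 set \<Rightarrow> 'a set \<Rightarrow> 'a \<times> 'a \<Rightarrow> ('a set \<Rightarrow> 'a set) set" where
  "pdom M L g = (Lbar_top M L) closure_of (iota M L ` dom0 L g)"

definition theta :: "'a::ring_1 set \<Rightarrow> 'a set \<Rightarrow> 'a \<times> 'a \<Rightarrow> ('a set \<Rightarrow> 'a set) \<Rightarrow> ('a set \<Rightarrow> 'a set)" where
  "theta M L g \<xi> = (THE \<eta>. limitin (Lbar_top M L) (\<lambda>y. iota M L (act g y)) \<eta>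
       (inf (filtercomap (iota M L) (nhdsin (Lbar_top M L) \<xi>)) (principal (dom0 L g))))"

definition gpd_arrows :: "'a::ring_1 set \<Rightarrow> 'a set \<Rightarrow> (('a \<times> 'a) \<times> ('a set \<Rightarrow> 'a set)) set" where
  "gpd_arrows M L = {(g, \<xi>). g \<in> grpG M L \<and> \<xi> \<in> pdom M L g}"

definition gpd_top :: "'a::ring_1 set \<Rightarrow> 'a set \<Rightarrow> (('a \<times> 'a) \<times> ('a set \<Rightarrow> 'a set)) topology" where
  "gpd_top M L = subtopology (prod_topology (discrete_topology (grpG M L)) (Lbar_top M L))
                             (gpd_arrows M L)"

definition gpd_src :: "('a \<times> 'a) \<times> ('a set \<Rightarrow> 'a set) \<Rightarrow> ('a set \<Rightarrow> 'a set)" where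
  "gpd_src \<gamma> = snd \<gamma>"

definition gpd_rng :: "'a::ring_1 set \<Rightarrow> 'a set \<Rightarrow> ('a \<times> 'a) \<times> ('a set \<Rightarrow> 'a set) \<Rightarrow> ('a set \<Rightarrow> 'a set)" where
  "gpd_rng M L \<gamma> = theta M L (fst \<gamma>) (snd \<gamma>)"

text \<open>(g, theta_h x) \<cdot> (h, x) = (gh, x), with (b,u)(c,v) = (b + u c, u v).\<close>
definition gpd_comp :: "('a::ring_1 \<times> 'a) \<times> ('a set \<Rightarrow> 'a set) \<Rightarrow> ('a \<times> 'a) \<times> ('a set \<Rightarrow> 'a set)
                        \<Rightarrow> ('a \<times> 'a) \<times> ('a set \<Rightarrow> 'a set)" where
  "gpd_comp \<gamma> \<delta> = ((fst (fst \<gamma>) + snd (fst \<gamma>) * fst (fst \<delta>), snd (fst \<gamma>) * snd (fst \<delta>)), snd \<delta>)"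

definition top_gpd_iso ::
  "'x set \<Rightarrow> 'x topology \<Rightarrow> ('x \<Rightarrow> 'u) \<Rightarrow> ('x \<Rightarrow> 'u) \<Rightarrow> ('x \<Rightarrow> 'x \<Rightarrow> 'x) \<Rightarrow>
   'y set \<Rightarrow> 'y topology \<Rightarrow> ('y \<Rightarrow> 'v) \<Rightarrow> ('y \<Rightarrow> 'v) \<Rightarrow> ('y \<Rightarrow> 'y \<Rightarrow> 'y) \<Rightarrow> bool" where
  "top_gpd_iso A1 T1 s1 r1 c1 A2 T2 s2 r2 c2 \<longleftrightarrow>
     (\<exists>\<Phi>. bij_betw \<Phi> A1 A2 \<and> homeomorphic_map T1 T2 \<Phi> \<and>
        (\<forall>\<gamma>\<in>A1. \<forall>\<delta>\<in>A1. (s1 \<gamma> = r1 \<delta> \<longleftrightarrow> s2 (\<Phi> \<gamma>) = r2 (\<Phi> \<delta>)) \<and>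
                         (s1 \<gamma> = r1 \<delta> \<longrightarrow> \<Phi> (c1 \<gamma> \<delta>) = c2 (\<Phi> \<gamma>) (\<Phi> \<delta>))))"

definition groupoids_iso :: "'a::ring_1 set \<Rightarrow> 'a set \<Rightarrow> 'b::ring_1 set \<Rightarrow> 'b set \<Rightarrow> bool" where
  "groupoids_iso M1 L1 M2 L2 \<longleftrightarrow>
     top_gpd_iso (gpd_arrows M1 L1) (gpd_top M1 L1) gpd_src (gpd_rng M1 L1) gpd_comp
                 (gpd_arrows M2 L2) (gpd_top M2 L2) gpd_src (gpd_rng M2 L2) gpd_comp"

end

theory Submission
  imports Defs
begin

text \<open>Since \<open>M\<close> is abelian and spans \<open>\<rat>R\<close>, the algebra \<open>\<rat>R\<close> is commutative. A groupoid isomorphism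
  \<open>\<Phi>\<close> has a locally constant group component \<open>c(g, x) \<in> M\<^sub>2\<^sup>-\<^sup>1\<L>\<^sub>2 \<rtimes> \<langle>M\<^sub>2\<rangle>\<close>, which is a cocycle. As \<open>\<L>\<^sub>1\<close> is
  finitely generated and its completion is compact, there is a finite index subgroup \<open>H\<close> such that
  \<open>c(b, x)\<close> depends only on \<open>x\<close> modulo \<open>H\<close> for all translations \<open>b \<in> \<L>\<^sub>1\<close>; hence \<open>\<rho>(b) = c(b, 0)\<close> is a
  homomorphism on \<open>H\<close>. For \<open>a \<in> M\<^sub>1\<close> the cocycle identity gives \<open>\<rho>(ab) = c(a, 0) \<rho>(b) c(a, 0)\<^sup>-\<^sup>1\<close> for
  \<open>b\<close> in a finite index subgroup, so \<open>\<rho>((1 - a)b)\<close> is a commutator and lies in \<open>M\<^sub>2\<^sup>-\<^sup>1\<L>\<^sub>2\<close>. If \<open>1 - a\<close> is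
  injective, then \<open>\<rho>\<close> therefore extends to a \<open>\<rat>\<close>-linear map \<open>\<alpha> : \<rat>R\<^sub>1 \<rightarrow> \<rat>R\<^sub>2\<close> with \<open>\<alpha>(ux) = \<tau>(u)\<alpha>(x)\<close>,
  where \<open>\<tau>(u) \<in> \<langle>M\<^sub>2\<rangle>\<close> is the linear part of \<open>c(u, 0)\<close>. It is injective because \<open>\<Phi>\<close> is. The same
  argument for the inverse of \<open>\<Phi>\<close> shows that the dimensions agree, so \<open>\<alpha>\<close> is bijective and
  \<open>x \<mapsto> \<alpha>(x)\<alpha>(1)\<^sup>-\<^sup>1\<close> is the desired algebra isomorphism.\<close>

section \<open>Finitely generated subgroups of a ring\<close>

lemma add_subgroup_zero: "add_subgroup H \<Longrightarrow> 0 \<in> H"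
  and add_subgroup_add: "add_subgroup H \<Longrightarrow> x \<in> H \<Longrightarrow> y \<in> H \<Longrightarrow> x + y \<in> H"
  and add_subgroup_minus: "add_subgroup H \<Longrightarrow> x \<in> H \<Longrightarrow> - x \<in> H"
  by (auto simp: add_subgroup_def)

lemma add_subgroup_diff: "add_subgroup H \<Longrightarrow> x \<in> H \<Longrightarrow> y \<in> H \<Longrightarrow> x - y \<in> H"
  using add_subgroup_add[of H x "- y"] add_subgroup_minus[of H y] by simp

lemma add_subgroup_of_nat: "add_subgroup H \<Longrightarrow> x \<in> H \<Longrightarrow> of_nat k * x \<in> H"
  by (induction k) (auto simp: distrib_right add_subgroup_zero add_subgroup_add)

lemma add_subgroup_of_int: "add_subgroup H \<Longrightarrow> x \<in> H \<Longrightarrow> of_int k * x \<in> H"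
  by (cases k rule: int_cases2) (simp_all add: add_subgroup_of_nat add_subgroup_minus)

lemma add_subgroup_sum:
  "add_subgroup H \<Longrightarrow> (\<And>i. i \<in> I \<Longrightarrow> f i \<in> H) \<Longrightarrow> sum f I \<in> H"
  by (induction I rule: infinite_finite_induct) (auto simp: add_subgroup_zero add_subgroup_add)

lemma add_subgroup_Int: "add_subgroup G \<Longrightarrow> add_subgroup H \<Longrightarrow> add_subgroup (G \<inter> H)"
  by (auto simp: add_subgroup_def)

lemma zspan_minimal: "add_subgroup H \<Longrightarrow> S \<subseteq> H \<Longrightarrow> zspan S \<subseteq> H"
  by (auto simp: zspan_def intro!: add_subgroup_sum add_subgroup_of_int)

lemma zspan_sumI: "finite F \<Longrightarrow> F \<subseteq> S \<Longrightarrow> (\<Sum>s\<in>F. of_int (c s) * s) \<in> zspan S"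
  unfolding zspan_def by blast

lemma zspan_superset: "S \<subseteq> zspan S"
proof
  fix s assume "s \<in> S"
  then show "s \<in> zspan S" using zspan_sumI[of "{s}" S "\<lambda>_. 1"] by simp
qed

lemma add_subgroup_zspan: "add_subgroup (zspan S)"
  unfolding add_subgroup_def
proof (intro conjI ballI)
  show "0 \<in> zspan S" using zspan_sumI[of "{}" S "\<lambda>_. 1"] by simp
next
  fix x assume "x \<in> zspan S"
  then obtain F c where F: "finite F" "F \<subseteq> S" "x = (\<Sum>s\<in>F. of_int (c s) * s)"
    by (auto simp: zspan_def)
  then show "- x \<in> zspan S"
    using zspan_sumI[of F S "\<lambda>s. - c s"] by (simp add: sum_negf)
next
  fix x y assume "x \<in> zspan S" "y \<in> zspan S"
  then obtain F c G d where F: "finite F" "F \<subseteq> S" "x = (\<Sum>s\<in>F. of_int (c s) * s)"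
    and G: "finite G" "G \<subseteq> S" "y = (\<Sum>s\<in>G. of_int (d s) * s)"
    by (auto simp: zspan_def)
  define e where "e s = (if s \<in> F then c s else 0) + (if s \<in> G then d s else 0)" for s
  have "x = (\<Sum>s\<in>F \<union> G. of_int (if s \<in> F then c s else 0) * s)"
    unfolding F(3) using F G by (intro sum.mono_neutral_cong_left) auto
  moreover have "y = (\<Sum>s\<in>F \<union> G. of_int (if s \<in> G then d s else 0) * s)"
    unfolding G(3) using F G by (intro sum.mono_neutral_cong_left) auto
  ultimately have "x + y = (\<Sum>s\<in>F \<union> G. of_int (e s) * s)"
    by (simp only: e_def sum.distrib[symmetric] distrib_right of_int_add)
  moreover have "finite (F \<union> G)" "F \<union> G \<subseteq> S" using F G by auto
  ultimately show "x + y \<in> zspan S" by (simp add: zspan_sumI)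
qed

lemma zspan_empty: "zspan {} = {0}"
  using zspan_minimal[of "{0}" "{}"] add_subgroup_zero[OF add_subgroup_zspan]
  by (auto simp: add_subgroup_def)

lemma zspan_finite:
  assumes "finite S"
  shows "zspan S = range (\<lambda>c. \<Sum>s\<in>S. of_int (c s) * s)"
proof (intro equalityI subsetI)
  fix x assume "x \<in> zspan S"
  then obtain F c where F: "finite F" "F \<subseteq> S" "x = (\<Sum>s\<in>F. of_int (c s) * s)"
    by (auto simp: zspan_def)
  have "x = (\<Sum>s\<in>S. of_int (if s \<in> F then c s else 0) * s)"
    unfolding F(3) using F assms by (intro sum.mono_neutral_cong_left) auto
  then show "x \<in> range (\<lambda>c. \<Sum>s\<in>S. of_int (c s) * s)"
    by (intro range_eqI[where x = "\<lambda>s. if s \<in> F then c s else 0"]) simp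
qed (use assms in \<open>auto simp: zspan_def\<close>)

lemma zspan_insert: "zspan (insert t T) = {of_int k * t + w |k w. w \<in> zspan T}" (is "_ = ?X")
proof
  have "add_subgroup ?X"
    unfolding add_subgroup_def
  proof (intro conjI ballI)
    show "0 \<in> ?X" using add_subgroup_zero[OF add_subgroup_zspan, of T]
      by (auto intro!: exI[of _ 0])
  next
    fix x assume "x \<in> ?X"
    then obtain k w where "w \<in> zspan T" "x = of_int k * t + w" by auto
    then have "- x = of_int (- k) * t + (- w)" "- w \<in> zspan T"
      by (auto simp: add_subgroup_minus add_subgroup_zspan)
    then show "- x \<in> ?X" by blast
  next
    fix x y assume "x \<in> ?X" "y \<in> ?X"
    then obtain k w l v where "w \<in> zspan T" "x = of_int k * t + w"
      "v \<in> zspan T" "y = of_int l * t + v" by auto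
    then have "x + y = of_int (k + l) * t + (w + v)" "w + v \<in> zspan T"
      by (auto simp: add_subgroup_add add_subgroup_zspan algebra_simps)
    then show "x + y \<in> ?X" by blast
  qed
  moreover have "insert t T \<subseteq> ?X"
  proof -
    have "t = of_int 1 * t + 0" "0 \<in> zspan T" "\<And>s. s = of_int 0 * t + s"
      by (auto simp: add_subgroup_zero add_subgroup_zspan)
    then show ?thesis using zspan_superset[of T] by blast
  qed
  ultimately show "zspan (insert t T) \<subseteq> ?X" by (rule zspan_minimal)
  have "zspan T \<subseteq> zspan (insert t T)"
    using zspan_superset by (intro zspan_minimal add_subgroup_zspan) blast
  then show "?X \<subseteq> zspan (insert t T)"
    using zspan_superset[of "insert t T"]
    by (auto intro!: add_subgroup_add[OF add_subgroup_zspan] add_subgroup_of_int[OF add_subgroup_zspan])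
qed

text \<open>Induction on the generators: an element of \<open>G\<close> whose coefficient at the new
  generator is minimal positive, together with generators of \<open>G \<inter> zspan T\<close>,
  suffices.\<close>

lemma fin_gen_subgroup:
  assumes "finite T" "add_subgroup G" "G \<subseteq> zspan T"
  shows "fin_gen G"
  using assms
proof (induction T arbitrary: G rule: finite_induct)
  case empty
  then have "G = {0}" by (auto simp: zspan_empty add_subgroup_def)
  then show ?case by (auto simp: fin_gen_def zspan_empty intro!: exI[of _ "{}"])
next
  case (insert t T)
  \<comment> \<open>The coefficient at \<open>t\<close> need not be unique, as \<open>t\<close> may
    be dependent on \<open>T\<close>; \<open>J\<close> collects every one that occurs in
    \<open>G\<close>.\<close>
  define J where "J = {k::int. \<exists>w\<in>zspan T. of_int k * t + w \<in> G}"
  note zs = add_subgroup_zspan[of T]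
  have Jneg: "- k \<in> J" if "k \<in> J" for k
  proof -
    obtain w where "w \<in> zspan T" "of_int k * t + w \<in> G" using \<open>k \<in> J\<close> by (auto simp: J_def)
    then have "- w \<in> zspan T" "of_int (- k) * t + - w \<in> G"
      using add_subgroup_minus[OF insert.prems(1), of "of_int k * t + w"] zs
      by (auto simp: add_subgroup_minus)
    then show ?thesis unfolding J_def by blast
  qed
  show ?case
  proof (cases "J \<subseteq> {0}")
    case True
    have "G \<subseteq> zspan T"
    proof
      fix x assume "x \<in> G"
      then obtain k w where kw: "w \<in> zspan T" "x = of_int k * t + w"
        using insert.prems(2) by (auto simp: zspan_insert)
      then have "k \<in> J" using \<open>x \<in> G\<close> by (auto simp: J_def)
      then show "x \<in> zspan T" using True kw by auto
    qed
    then show ?thesis using insert by blast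
  next
    case False
    then obtain k where "k \<in> J" "k \<noteq> 0" by auto
    then have "\<exists>d::nat. d > 0 \<and> int d \<in> J"
      using Jneg[of k] by (intro exI[of _ "nat \<bar>k\<bar>"]) (auto simp: abs_if)
    then obtain d where d: "d > 0" "int d \<in> J" and dmin: "\<And>e. 0 < e \<Longrightarrow> int e \<in> J \<Longrightarrow> d \<le> e"
      using exists_least_iff[of "\<lambda>d. d > 0 \<and> int d \<in> J"] by (metis linorder_not_le)
    obtain v where v: "v \<in> zspan T" "of_int (int d) * t + v \<in> G"
      using d(2) unfolding J_def by blast
    define g where "g = of_int (int d) * t + v"
    have sub: "add_subgroup (G \<inter> zspan T)"
      using insert.prems(1) zs by (rule add_subgroup_Int)
    then obtain S where S: "finite S" "S \<subseteq> G \<inter> zspan T" "zspan S = G \<inter> zspan T"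
      using insert.IH[of "G \<inter> zspan T"] by (auto simp: fin_gen_def)
    have "G \<subseteq> zspan (insert g S)"
    proof
      fix x assume x: "x \<in> G"
      then obtain k w where kw: "w \<in> zspan T" "x = of_int k * t + w"
        using insert.prems(2) by (auto simp: zspan_insert)
      \<comment> \<open>Division by the least positive \<open>d\<close> leaves a remainder in
        \<open>J\<close> below \<open>d\<close>, hence zero; subtracting \<open>q\<close> copies of
        \<open>g\<close> lands in \<open>G \<inter> zspan T\<close>.\<close>
      define q r where "q = k div int d" and "r = k mod int d"
      have k: "k = q * int d + r" by (simp add: q_def r_def)
      have eq: "x - of_int q * g = of_int r * t + (w - of_int q * v)"
        unfolding kw g_def k by (simp add: algebra_simps)
      have mem: "w - of_int q * v \<in> zspan T"
        using kw v zs by (intro add_subgroup_diff add_subgroup_of_int)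
      have xg: "x - of_int q * g \<in> G"
        using x v insert.prems(1) unfolding g_def by (intro add_subgroup_diff add_subgroup_of_int)
      then have "r \<in> J" unfolding eq J_def using mem by blast
      moreover have "0 \<le> r" "r < int d" using d by (auto simp: r_def)
      ultimately have "r = 0" using dmin[of "nat r"] by (cases "r = 0") auto
      then have "x - of_int q * g \<in> zspan S" using eq mem xg S by auto
      moreover have "x = of_int q * g + (x - of_int q * g)" by simp
      ultimately show "x \<in> zspan (insert g S)" unfolding zspan_insert by blast
    qed
    moreover have gS: "insert g S \<subseteq> G" using v S by (auto simp: g_def)
    moreover have "zspan (insert g S) \<subseteq> G"
      using insert.prems(1) gS by (rule zspan_minimal)
    ultimately have "zspan (insert g S) = G" by blast
    then show ?thesis using gS S(1) unfolding fin_gen_def by blast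
  qed
qed

section \<open>Integer relations and integrality\<close>

lemma of_int_left_commute: "of_int a * (of_int b * x) = of_int b * (of_int a * (x::'a::ring_1))"
  by (metis mult.assoc mult.commute of_int_mult)

text \<open>Gaussian elimination without division: a vector \<open>v j\<close> with nonzero
  coefficient at \<open>t\<close> removes \<open>t\<close> from the other vectors, leaving one
  vector and one generator fewer.\<close>

lemma integer_relation_exists:
  assumes "finite T" "finite I" "card T < card I" "\<And>i. i \<in> I \<Longrightarrow> v i \<in> zspan T"
  shows "\<exists>c. (\<exists>i\<in>I. c i \<noteq> 0) \<and> (\<Sum>i\<in>I. of_int (c i) * v i) = 0"
  using assms
proof (induction T arbitrary: I v rule: finite_induct)
  case empty
  then have "I \<noteq> {}" "\<And>i. i \<in> I \<Longrightarrow> v i = 0" by (auto simp: zspan_empty)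
  then show ?case by (intro exI[of _ "\<lambda>_. 1"]) auto
next
  case (insert t T)
  have "\<forall>i\<in>I. \<exists>k w. w \<in> zspan T \<and> v i = of_int k * t + w"
    using insert.prems(3) unfolding zspan_insert by blast
  then obtain k w where kw: "\<And>i. i \<in> I \<Longrightarrow> w i \<in> zspan T \<and> v i = of_int (k i) * t + w i"
    by metis
  show ?case
  proof (cases "\<forall>i\<in>I. k i = 0")
    case True
    then have "v i \<in> zspan T" if "i \<in> I" for i using that kw[of i] by simp
    moreover have "card T < card I" using insert by simp
    ultimately show ?thesis using insert by blast
  next
    case False
    then obtain j where j: "j \<in> I" "k j \<noteq> 0" by auto
    define v' where "v' i = of_int (k j) * v i - of_int (k i) * v j" for i
    have "v' i \<in> zspan T" if "i \<in> I - {j}" for i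
    proof -
      have "v' i = of_int (k j) * w i - of_int (k i) * w j"
        using kw[of i] kw[of j] that j
        by (simp add: v'_def distrib_left of_int_left_commute[of "k i" "k j"])
      then show ?thesis using kw[of i] kw[of j] that j add_subgroup_zspan[of T]
        by (auto intro!: add_subgroup_diff add_subgroup_of_int)
    qed
    moreover have "card T < card (I - {j})" using insert j by simp
    ultimately obtain c where c: "\<exists>i\<in>I - {j}. c i \<noteq> 0" "(\<Sum>i\<in>I - {j}. of_int (c i) * v' i) = 0"
      using insert.IH[of "I - {j}" v'] insert.prems by auto
    \<comment> \<open>Substituting \<open>v' i\<close> back gathers all multiples of
      \<open>v j\<close> in one coefficient; the others are scaled by \<open>k j\<close>, which is
      nonzero.\<close>
    define c' where "c' i = (if i = j then - (\<Sum>i\<in>I - {j}. c i * k i) else c i * k j)" for i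
    have "(\<Sum>i\<in>I. of_int (c' i) * v i)
        = of_int (c' j) * v j + (\<Sum>i\<in>I - {j}. of_int (c' i) * v i)"
      using insert.prems(1) j by (simp add: sum.remove)
    also have "\<dots> = (\<Sum>i\<in>I - {j}. of_int (c i) * v' i)"
      by (simp add: c'_def v'_def right_diff_distrib sum_subtractf sum_distrib_right mult.assoc)
    finally have "(\<Sum>i\<in>I. of_int (c' i) * v i) = 0" using c by simp
    moreover have "\<exists>i\<in>I. c' i \<noteq> 0" using c(1) j by (auto simp: c'_def)
    ultimately show ?thesis by blast
  qed
qed

lemma zindep_card_le:
  assumes "finite T" "finite S" "S \<subseteq> zspan T" "zindep S"
  shows "card S \<le> card T"
proof (rule ccontr)
  assume "\<not> card S \<le> card T"
  then obtain c where "\<exists>i\<in>S. c i \<noteq> (0::int)" "(\<Sum>i\<in>S. of_int (c i) * i) = 0"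
    using integer_relation_exists[of T S "\<lambda>s. s"] assms(1,2,3) by (auto simp: subset_eq)
  then show False using assms unfolding zindep_def by blast
qed

text \<open>The spans of the powers of \<open>x\<close> below \<open>n\<close> increase with
  \<open>n\<close>, and their union is finitely generated as a subgroup of \<open>R\<close>, so it
  equals one of them. Then \<open>x ^ n\<close> lies in that span, which is a monic
  relation.\<close>

lemma zintegral_of_fin_gen:
  assumes "unital_subring R" "fin_gen R" "x \<in> R"
  shows "zintegral x"
proof -
  obtain T where T: "finite T" "zspan T = R" using assms by (auto simp: fin_gen_def)
  have R: "add_subgroup R" "1 \<in> R" "\<And>x y. x \<in> R \<Longrightarrow> y \<in> R \<Longrightarrow> x * y \<in> R"
    using assms by (auto simp: unital_subring_def)
  have pow: "x ^ i \<in> R" for i by (induction i) (auto simp: R assms)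
  define A where "A n = zspan ((\<lambda>i. x ^ i) ` {..<n})" for n :: nat
  have A_mono: "A m \<subseteq> A n" if "m \<le> n" for m n
    unfolding A_def using zspan_superset[of "(\<lambda>i. x ^ i) ` {..<n}"] that
    by (intro zspan_minimal add_subgroup_zspan) force
  have A_sub: "add_subgroup (A n)" for n unfolding A_def by (rule add_subgroup_zspan)
  have "add_subgroup (\<Union>n. A n)"
    unfolding add_subgroup_def
  proof (intro conjI ballI)
    fix a b assume "a \<in> (\<Union>n. A n)" "b \<in> (\<Union>n. A n)"
    then obtain m n where "a \<in> A m" "b \<in> A n" by auto
    then have "a + b \<in> A (max m n)"
      using A_mono[of m "max m n"] A_mono[of n "max m n"] by (intro add_subgroup_add A_sub) auto
    then show "a + b \<in> (\<Union>n. A n)" by blast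
  qed (use A_sub in \<open>auto simp: add_subgroup_def\<close>)
  moreover have "(\<Union>n. A n) \<subseteq> zspan T"
    unfolding T A_def using R(1) pow by (intro UN_least zspan_minimal) auto
  ultimately have "fin_gen (\<Union>n. A n)" using T(1) by (intro fin_gen_subgroup)
  then obtain S where S: "finite S" "S \<subseteq> (\<Union>n. A n)" "zspan S = (\<Union>n. A n)"
    by (auto simp: fin_gen_def)
  have "\<exists>n. S \<subseteq> A n"
    using S(1,2)
  proof (induction S)
    case (insert s S)
    then obtain m n where "s \<in> A m" "S \<subseteq> A n" by auto
    then have "insert s S \<subseteq> A (max m n)"
      using A_mono[of m "max m n"] A_mono[of n "max m n"] by auto
    then show ?case by blast
  qed simp
  then obtain n where "S \<subseteq> A n" by blast
  then have "zspan S \<subseteq> A n" by (intro zspan_minimal A_sub)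
  moreover have "x ^ n \<in> A (Suc n)"
    unfolding A_def using zspan_superset[of "(\<lambda>i. x ^ i) ` {..<Suc n}"] by blast
  ultimately have xn: "x ^ n \<in> A n" using S(3) by blast
  \<comment> \<open>Powers with different exponents may coincide, so the span of the set of powers
    is first rewritten as sums indexed by exponents.\<close>
  have "A n \<subseteq> range (\<lambda>c. \<Sum>i<n. of_int (c i) * x ^ i)" (is "_ \<subseteq> ?X")
    unfolding A_def
  proof (rule zspan_minimal)
    show "add_subgroup ?X"
      unfolding add_subgroup_def
    proof (intro conjI ballI)
      show "0 \<in> ?X" by (rule range_eqI[where x = "\<lambda>_. 0"]) simp
    next
      fix a assume "a \<in> ?X"
      then obtain c where "a = (\<Sum>i<n. of_int (c i) * x ^ i)" by auto
      then show "- a \<in> ?X"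
        by (intro range_eqI[where x = "\<lambda>i. - c i"]) (simp add: sum_negf)
    next
      fix a b assume "a \<in> ?X" "b \<in> ?X"
      then obtain c d where "a = (\<Sum>i<n. of_int (c i) * x ^ i)" "b = (\<Sum>i<n. of_int (d i) * x ^ i)"
        by auto
      then show "a + b \<in> ?X"
        by (intro range_eqI[where x = "\<lambda>i. c i + d i"]) (simp add: sum.distrib distrib_right)
    qed
    show "(\<lambda>i. x ^ i) ` {..<n} \<subseteq> ?X"
    proof safe
      fix i assume "i < n"
      then show "x ^ i \<in> ?X"
        by (intro range_eqI[where x = "\<lambda>j. if j = i then 1 else 0"]) (simp add: if_distrib if_distribR cong: if_cong)
    qed
  qed
  then obtain c where "x ^ n = (\<Sum>i<n. of_int (c i) * x ^ i)" using xn by auto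
  then have "x ^ n + (\<Sum>i<n. of_int (- c i) * x ^ i) = 0" by (simp add: sum_negf)
  then show ?thesis unfolding zintegral_def by (intro exI[of _ n] exI[of _ "\<lambda>i. - c i"])
qed

section \<open>Additive maps and independence\<close>

lemma additive_of_int:
  fixes f :: "'a::ring_1 \<Rightarrow> 'b::ring_1"
  assumes add: "\<And>x y. f (x + y) = f x + f y"
  shows "f (of_int k * x) = of_int k * f x"
proof -
  have zero: "f 0 = 0" using add[of 0 0] by simp
  have minus: "f (- y) = - f y" for y
    using add[of y "- y"] zero by (simp add: add_eq_0_iff2 add.commute)
  have "f (of_nat n * x) = of_nat n * f x" for n
    by (induction n) (simp_all add: zero distrib_right add)
  then show ?thesis by (cases k rule: int_cases2) (simp_all add: minus)
qed

lemma additive_of_nat: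
  fixes f :: "'a::ring_1 \<Rightarrow> 'b::ring_1"
  assumes "\<And>x y. f (x + y) = f x + f y"
  shows "f (of_nat k * x) = of_nat k * f x"
  using additive_of_int[of f "int k"] assms by simp

lemma additive_sum:
  fixes f :: "'a::ring_1 \<Rightarrow> 'b::ring_1"
  assumes add: "\<And>x y. f (x + y) = f x + f y"
  shows "f (sum g I) = (\<Sum>i\<in>I. f (g i))"
proof -
  have "f 0 = 0" using add[of 0 0] by simp
  then show ?thesis by (induction I rule: infinite_finite_induct) (simp_all add: add)
qed

text \<open>The kernel condition concerns only \<open>zspan S\<close>, so that multiplication by an
  element known to be injective on a lattice is covered too.\<close>

lemma zindep_image:
  fixes f :: "'a::ring_1 \<Rightarrow> 'b::ring_1"
  assumes add: "\<And>x y. f (x + y) = f x + f y"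
    and ker: "\<And>x. x \<in> zspan S \<Longrightarrow> f x = 0 \<Longrightarrow> x = 0"
    and S: "zindep S"
  shows "inj_on f S" "zindep (f ` S)"
proof -
  show "inj_on f S"
  proof (rule inj_onI)
    fix s t assume st: "s \<in> S" "t \<in> S" "f s = f t"
    have "s - t \<in> zspan S"
      using st zspan_superset[of S] by (intro add_subgroup_diff add_subgroup_zspan) auto
    moreover have "f (s - t) = 0" using add[of "s - t" t] st by simp
    ultimately show "s = t" using ker by force
  qed
  show "zindep (f ` S)"
    unfolding zindep_def
  proof (intro allI impI)
    fix F c assume *: "finite F \<and> F \<subseteq> f ` S \<and> (\<Sum>s\<in>F. of_int (c s) * s) = 0"
    then obtain E where E: "E \<subseteq> S" "inj_on f E" "F = f ` E"
      by (meson subset_image_inj)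
    have fin: "finite E" using * E finite_imageD by blast
    have "f (\<Sum>s\<in>E. of_int (c (f s)) * s) = (\<Sum>s\<in>F. of_int (c s) * s)"
      using E by (simp add: additive_sum[of f, OF add] additive_of_int[of f, OF add] sum.reindex)
    then have "(\<Sum>s\<in>E. of_int (c (f s)) * s) = 0"
      using * ker zspan_sumI[of E S "\<lambda>s. c (f s)"] fin E by simp
    moreover have "finite E \<and> E \<subseteq> S \<and> (\<Sum>s\<in>E. of_int ((\<lambda>s. c (f s)) s) * s) = 0
        \<longrightarrow> (\<forall>s\<in>E. (\<lambda>s. c (f s)) s = 0)"
      using S[unfolded zindep_def, THEN spec, of E, THEN spec, of "\<lambda>s. c (f s)"] .
    ultimately have "\<forall>s\<in>E. c (f s) = 0" using E(1) fin by simp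
    then show "\<forall>s\<in>F. c s = 0" using E by simp
  qed
qed

text \<open>For a subgroup of a full rank lattice this says that the index is finite; in this form
  it passes to finite intersections and preimages without counting cosets.\<close>

definition full_subgroup :: "'a::ring_1 set \<Rightarrow> bool" where
  "full_subgroup H \<longleftrightarrow> add_subgroup H \<and> (\<forall>x. \<exists>n::nat. n > 0 \<and> of_nat n * x \<in> H)"

lemma full_subgroup_multiple:
  assumes "full_subgroup H"
  obtains n :: nat where "n > 0" "of_nat n * x \<in> H"
  using assms unfolding full_subgroup_def by blast

lemma full_subgroup_Int:
  assumes "full_subgroup G" "full_subgroup H"
  shows "full_subgroup (G \<inter> H)"
  unfolding full_subgroup_def
proof (intro conjI allI)
  show "add_subgroup (G \<inter> H)" using assms by (simp add: full_subgroup_def add_subgroup_Int)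
  fix x
  obtain m n where mn: "m > 0" "of_nat m * x \<in> G" "n > 0" "of_nat n * (of_nat m * x) \<in> H"
    using assms unfolding full_subgroup_def by meson
  moreover have "of_nat n * (of_nat m * x) \<in> G"
    using mn assms by (auto simp: full_subgroup_def intro: add_subgroup_of_nat)
  ultimately show "\<exists>k::nat. k > 0 \<and> of_nat k * x \<in> G \<inter> H"
    by (intro exI[of _ "n * m"]) (simp add: mult.assoc)
qed

text \<open>The factor \<open>L\<close> keeps the result inside the lattice even for empty
  \<open>F\<close>, where \<open>\<Inter>F\<close> is the whole type.\<close>

lemma full_subgroup_INT:
  assumes "finite F" "\<And>C. C \<in> F \<Longrightarrow> full_subgroup C" "full_subgroup L"
  shows "full_subgroup (L \<inter> \<Inter>F)"
  using assms
proof (induction F)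
  case (insert C F)
  have "L \<inter> \<Inter>(insert C F) = C \<inter> (L \<inter> \<Inter>F)" by auto
  then show ?case using insert by (simp add: full_subgroup_Int)
qed simp

lemma full_subgroup_common_multiple:
  assumes H: "full_subgroup H" and S: "finite S"
  shows "\<exists>n::nat. n > 0 \<and> (\<forall>s\<in>S. of_nat n * s \<in> H)"
  using S
proof (induction S)
  case (insert s S)
  then obtain n where n: "n > 0" "\<forall>s\<in>S. of_nat n * s \<in> H" by auto
  obtain m where m: "m > 0" "of_nat m * (of_nat n * s) \<in> H"
    using H unfolding full_subgroup_def by meson
  have "of_nat (m * n) * t \<in> H" if "t \<in> insert s S" for t
    using that n m H by (auto simp: mult.assoc full_subgroup_def intro: add_subgroup_of_nat)
  then show ?case using n m by (intro exI[of _ "m * n"]) auto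
qed (auto intro: exI[of _ 1])

lemma full_subgroup_mono:
  "full_subgroup G \<Longrightarrow> G \<subseteq> H \<Longrightarrow> add_subgroup H \<Longrightarrow> full_subgroup H"
  unfolding full_subgroup_def by blast

section \<open>Inverses of units\<close>

lemma qinv_right: "qunit a \<Longrightarrow> a * qinv a = 1"
  and qinv_left: "qunit a \<Longrightarrow> qinv a * a = 1"
proof -
  assume "qunit a"
  then obtain y where y: "a * y = 1 \<and> y * a = 1" by (auto simp: qunit_def)
  have "a * qinv a = 1 \<and> qinv a * a = 1"
    unfolding qinv_def
  proof (rule theI[of _ y])
    show "z = y" if z: "a * z = 1 \<and> z * a = 1" for z
    proof -
      have "z = (y * a) * z" using y by simp
      also have "\<dots> = y * (a * z)" by (rule mult.assoc)
      finally show ?thesis using z by simp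
    qed
  qed (use y in simp_all)
  then show "a * qinv a = 1" "qinv a * a = 1" by simp_all
qed

lemma qunit_cancel: "qunit a \<Longrightarrow> a * x = a * y \<longleftrightarrow> x = y"
  by (metis mult.assoc mult_1 qinv_left)

section \<open>The ambient algebra of a lattice action\<close>

text \<open>The hypotheses of the theorem for one index; by \<open>is_QR\<close> the whole type
  \<open>'a\<close> is the algebra \<open>QR\<close>.\<close>

locale lattice_action =
  fixes R M L :: "'a::ring_1 set"
  assumes R: "unital_subring R" "fin_gen R" "is_QR R"
    and M: "abelian_submonoid_regular R M" "finite_index (zspan M) R"
    and L: "add_subgroup L" "L \<subseteq> R" "zrank L = zrank R" "\<forall>a\<in>M. \<forall>x\<in>L. a * x \<in> L"
    and inj: "\<exists>a\<in>M. inj_on (\<lambda>x. (1 - a) * x) L"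
begin

lemma R_subgroup: "add_subgroup R"
  using R(1) by (simp add: unital_subring_def)

lemma M_subset: "M \<subseteq> R" and M_one: "1 \<in> M" and M_mult: "a \<in> M \<Longrightarrow> b \<in> M \<Longrightarrow> a * b \<in> M"
  using M(1) by (auto simp: abelian_submonoid_regular_def left_regular_def)

section \<open>Divisibility and rank\<close>

lemma of_nat_divide: "n > 0 \<Longrightarrow> \<exists>y::'a. of_nat n * y = x"
proof -
  assume "n > 0"
  then obtain z :: 'a where "of_nat n * z = 1" using R(3) by (auto simp: is_QR_def)
  then have "of_nat n * (z * x) = x" by (simp add: mult.assoc[symmetric])
  then show ?thesis by blast
qed

lemma of_nat_cancel: "n > 0 \<Longrightarrow> of_nat n * x = of_nat n * (y::'a) \<longleftrightarrow> x = y"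
proof -
  assume "n > 0"
  then obtain z :: 'a where z: "z * of_nat n = 1" using R(3) unfolding is_QR_def by blast
  have "x = y" if "of_nat n * x = of_nat n * y"
    using arg_cong[OF that, of "(*) z"] z by (simp add: mult.assoc[symmetric])
  then show ?thesis by blast
qed

lemma torsion_free: "n > 0 \<Longrightarrow> of_nat n * x = 0 \<Longrightarrow> x = (0::'a)"
  using of_nat_cancel[of n x 0] by simp

lemma full_R: "full_subgroup R"
  using R_subgroup R(3) by (auto simp: full_subgroup_def is_QR_def)

text \<open>The supremum defining \<^const>\<open>zrank\<close> is junk for unbounded sets of naturals, so this bound is
  needed before any rank can be used.\<close>

lemma finite_zindep_cards:
  assumes "G \<subseteq> R"
  shows "finite {card S |S. finite S \<and> S \<subseteq> G \<and> zindep S}"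
proof -
  obtain T where T: "finite T" "zspan T = R" using R(2) by (auto simp: fin_gen_def)
  have "{card S |S. finite S \<and> S \<subseteq> G \<and> zindep S} \<subseteq> {..card T}"
    using zindep_card_le[OF T(1)] T(2) assms by blast
  then show ?thesis by (rule finite_subset) simp
qed

text \<open>Multiplication by a common denominator is injective and moves \<open>S\<close> into
  \<open>R\<close>, which brings independent sets of the whole algebra under the bound.\<close>

lemma card_zindep_le:
  fixes S :: "'a set"
  assumes "finite S" "zindep S"
  shows "card S \<le> zrank R"
proof -
  obtain n where n: "n > 0" "\<forall>s\<in>S. of_nat n * s \<in> R"
    using full_subgroup_common_multiple[OF full_R assms(1)] by blast
  define f where "f = (\<lambda>s::'a. of_nat n * s)"
  have f: "inj_on f S" "zindep (f ` S)"
    using zindep_image[of f S] assms(2) torsion_free[OF n(1)] by (auto simp: f_def distrib_left)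
  have "card (f ` S) \<le> zrank R"
    unfolding zrank_def
    using f n assms finite_zindep_cards[of R]
    by (intro cSup_upper bdd_above_finite) (auto simp: f_def intro!: exI[of _ "f ` S"])
  then show ?thesis using f by (simp add: card_image)
qed

lemma zrank_attained: "\<exists>S. finite S \<and> S \<subseteq> L \<and> zindep S \<and> card S = zrank R"
proof -
  let ?X = "{card S |S. finite S \<and> S \<subseteq> L \<and> zindep S}"
  have "card {} \<in> ?X" by (force simp: zindep_def)
  \<comment> \<open>The empty set makes \<open>?X\<close> nonempty, so the supremum of this finite
    set is its maximum.\<close>
  then have "Sup ?X \<in> ?X"
    using finite_zindep_cards[OF L(2)] by (metis (no_types, lifting) Max_in Sup_nat_def empty_iff)
  then show ?thesis using L(3) unfolding zrank_def[of L] by force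
qed

text \<open>By maximality \<open>insert x S\<close> is dependent. The coefficient of
  \<open>x\<close> in a relation cannot vanish, since otherwise \<open>S\<close> would be dependent,
  so a multiple of \<open>x\<close> lies in the span.\<close>

lemma max_zindep_full:
  fixes S :: "'a set"
  assumes S: "finite S" "zindep S" "zrank R \<le> card S"
  shows "full_subgroup (zspan S)"
  unfolding full_subgroup_def
proof (intro conjI allI add_subgroup_zspan)
  fix x
  show "\<exists>n::nat. n > 0 \<and> of_nat n * x \<in> zspan S"
  proof (cases "x \<in> S")
    case True
    then show ?thesis using zspan_superset[of S] by (intro exI[of _ 1]) auto
  next
    case False
    then have "\<not> zindep (insert x S)"
      using card_zindep_le[of "insert x S"] S by auto
    then obtain F c s where F: "finite F" "F \<subseteq> insert x S" "(\<Sum>s\<in>F. of_int (c s) * s) = 0"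
      "s \<in> F" "c s \<noteq> 0" unfolding zindep_def by blast
    have sum_S: "(\<Sum>s\<in>F - {x}. of_int (c s) * s) \<in> zspan S"
      using F by (intro zspan_sumI) auto
    have "x \<in> F \<and> c x \<noteq> 0"
    proof (rule ccontr)
      assume "\<not> (x \<in> F \<and> c x \<noteq> 0)"
      then have "(\<Sum>s\<in>F - {x}. of_int (c s) * s) = 0" "s \<in> F - {x}"
        using F by (auto simp: sum_diff1)
      then show False using S(2) F unfolding zindep_def
        by (metis (no_types, lifting) Diff_subset_conv finite_Diff insert_is_Un)
    qed
    then have "of_int (c x) * x = - (\<Sum>s\<in>F - {x}. of_int (c s) * s)"
      using F by (simp add: sum_diff1)
    then have mem: "of_int (c x) * x \<in> zspan S"
      using sum_S by (simp add: add_subgroup_minus add_subgroup_zspan)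
    \<comment> \<open>\<open>full_subgroup\<close> asks for a positive natural multiple, hence the
      correction by the sign of \<open>c x\<close>.\<close>
    have "of_nat (nat \<bar>c x\<bar>) * x = of_int (sgn (c x)) * (of_int (c x) * x)"
      by (simp add: mult.assoc[symmetric] sgn_if)
    then have "of_nat (nat \<bar>c x\<bar>) * x \<in> zspan S"
      using mem by (simp only: add_subgroup_of_int add_subgroup_zspan)
    then show ?thesis using \<open>x \<in> F \<and> c x \<noteq> 0\<close> by (intro exI[of _ "nat \<bar>c x\<bar>"]) auto
  qed
qed

lemma lattice_basis: "\<exists>S. finite S \<and> S \<subseteq> L \<and> zindep S \<and> card S = zrank R \<and> full_subgroup (zspan S)"
  using zrank_attained max_zindep_full by (metis order_refl)

lemma full_L: "full_subgroup L"
  using lattice_basis L(1) zspan_minimal full_subgroup_mono by metis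

text \<open>Pigeonhole: the multiples of a point of \<open>R\<close> fall into finitely many cosets
  of \<open>zspan M\<close>, so two of them differ by an element of \<open>zspan M\<close>.\<close>

lemma full_zspan_M: "full_subgroup (zspan M)"
  unfolding full_subgroup_def
proof (intro conjI allI add_subgroup_zspan)
  fix x
  obtain n where n: "n > 0" "of_nat n * x \<in> R" using full_R by (auto simp: full_subgroup_def)
  define f where "f j = (\<lambda>h. of_nat j * (of_nat n * x) + h) ` zspan M" for j :: nat
  have "range f \<subseteq> (\<lambda>x. (\<lambda>h. x + h) ` zspan M) ` R"
    using add_subgroup_of_nat[OF R_subgroup n(2)] by (auto simp: f_def)
  then have "finite (range f)" using M(2) unfolding finite_index_def by (rule finite_subset)
  then have "\<not> inj f" using finite_imageD[of f UNIV] by auto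
  then obtain i j where "f i = f j" "i \<noteq> j" by (auto simp: inj_def)
  then obtain i j where ij: "f i = f j" "i < j" by (metis linorder_neqE_nat)
  have "of_nat j * (of_nat n * x) \<in> f j"
    unfolding f_def using add_subgroup_zero[OF add_subgroup_zspan, of M] by (force intro: image_eqI[of _ _ 0])
  then obtain h where h: "h \<in> zspan M" "of_nat j * (of_nat n * x) = of_nat i * (of_nat n * x) + h"
    using ij(1) unfolding f_def by force
  have "of_nat ((j - i) * n) * x = h"
    using h(2) ij(2) by (simp add: of_nat_diff left_diff_distrib mult.assoc)
  then show "\<exists>n::nat. n > 0 \<and> of_nat n * x \<in> zspan M"
    using h(1) ij(2) n(1) by (intro exI[of _ "(j - i) * n"]) simp
qed

text \<open>Centralizers are subgroups, so commutation passes from \<open>M\<close> to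
  \<open>zspan M\<close>, one factor at a time, and then to all elements after clearing
  denominators.\<close>

lemma mult_commute: "x * y = y * (x::'a)"
proof -
  have cent: "add_subgroup {x. \<forall>y\<in>Y. x * y = y * x}" for Y :: "'a set"
    by (auto simp: add_subgroup_def distrib_left distrib_right)
  have "zspan M \<subseteq> {x. \<forall>y\<in>M. x * y = y * x}"
    using M(1) by (intro zspan_minimal cent) (auto simp: abelian_submonoid_regular_def)
  then have "zspan M \<subseteq> {x. \<forall>y\<in>zspan M. x * y = y * x}"
    by (intro zspan_minimal cent) auto
  moreover obtain m n where mn: "m > 0" "of_nat m * x \<in> zspan M" "n > 0" "of_nat n * y \<in> zspan M"
    using full_zspan_M full_subgroup_multiple by metis
  ultimately have "(of_nat m * x) * (of_nat n * y) = (of_nat n * y) * (of_nat m * x)" by auto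
  moreover have "(of_nat k * u) * (of_nat l * v) = of_nat (k * l) * (u * v)" for k l and u v :: 'a
    by (metis mult.assoc mult_of_nat_commute of_nat_mult)
  ultimately have "of_nat (m * n) * (x * y) = of_nat (m * n) * (y * x)"
    by (simp add: mult.commute[of n m])
  then show ?thesis using of_nat_cancel[of "m * n"] mn by simp
qed

lemma mult_left_commute: "x * (y * z) = y * (x * (z::'a))"
  by (metis mult.assoc mult_commute)

text \<open>Multiplication by \<open>b\<close> carries a maximal independent subset of
  \<open>L\<close> to one of the same size, so its range contains a positive integer
  \<open>n\<close>. If \<open>n = b * s\<close>, then \<open>s\<close> divided by \<open>n\<close>
  inverts \<open>b\<close>.\<close>

lemma qunit_if_injective:
  assumes "\<And>x. x \<in> L \<Longrightarrow> b * x = 0 \<Longrightarrow> x = 0"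
  shows "qunit b"
proof -
  obtain S where S: "finite S" "S \<subseteq> L" "zindep S" "card S = zrank R" using lattice_basis by blast
  have sp: "zspan S \<subseteq> L" using S L(1) by (intro zspan_minimal)
  have *: "inj_on ((*) b) S" "zindep ((*) b ` S)"
    using zindep_image[of "(*) b" S] S(3) sp assms by (auto simp: distrib_left)
  then have "full_subgroup (zspan ((*) b ` S))"
    using S by (intro max_zindep_full) (auto simp: card_image)
  then obtain n where n: "n > 0" "of_nat n * 1 \<in> zspan ((*) b ` S)"
    unfolding full_subgroup_def by blast
  have "add_subgroup (range ((*) b))"
    unfolding add_subgroup_def
    by (auto simp: distrib_left[symmetric] intro: range_eqI[of _ _ 0] range_eqI[of _ _ "- _"])
  then have "zspan ((*) b ` S) \<subseteq> range ((*) b)" by (intro zspan_minimal) auto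
  then obtain s where s: "of_nat n = b * s" using n by auto
  obtain y where y: "of_nat n * y = s" using of_nat_divide[OF n(1)] by blast
  have "of_nat n * (b * y) = of_nat n * 1" using s y by (metis mult_left_commute mult_1_right)
  then have "b * y = 1" using of_nat_cancel[OF n(1)] by blast
  then show ?thesis unfolding qunit_def using mult_commute by metis
qed

section \<open>Units, fractions and the acting group\<close>

lemma qunit_M: "a \<in> M \<Longrightarrow> qunit a"
  using M(1) L(2) by (intro qunit_if_injective) (auto simp: abelian_submonoid_regular_def left_regular_def)

text \<open>Turns the injectivity hypothesis on \<open>L\<close> into invertibility in
  \<open>QR\<close>; this is what later makes linear parts trivial on a full subgroup of
  translations.\<close>

lemma qunit_one_minus: "\<exists>a\<in>M. qunit (1 - a)"
proof -
  obtain a where "a \<in> M" "inj_on (\<lambda>x. (1 - a) * x) L" using inj by blast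
  then have "qunit (1 - a)"
    using add_subgroup_zero[OF L(1)] inj_onD[of "\<lambda>x. (1 - a) * x" L _ 0]
    by (intro qunit_if_injective) auto
  then show ?thesis using \<open>a \<in> M\<close> by blast
qed

text \<open>As \<open>M\<close> is abelian, the group it generates consists of fractions
  \<open>b / a\<close>; the form \<open>a * u = b\<close> avoids \<open>qinv\<close>.\<close>

lemma grp_gen_fraction: "u \<in> grp_gen M \<Longrightarrow> \<exists>a\<in>M. \<exists>b\<in>M. a * u = b"
proof (induction rule: grp_gen.induct)
  case (mult x y)
  then obtain a b c d where "a \<in> M" "b \<in> M" "a * x = b" "c \<in> M" "d \<in> M" "c * y = d" by blast
  then have "(a * c) * (x * y) = b * d" "a * c \<in> M" "b * d \<in> M"
    by (auto simp: M_mult) (metis mult.assoc mult_left_commute)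
  then show ?case by blast
next
  case (inv a)
  then show ?case using M_one qinv_right[OF qunit_M] by blast
qed (use M_one in \<open>auto intro: bexI[of _ 1]\<close>)

lemma qunit_grp_gen: "u \<in> grp_gen M \<Longrightarrow> qunit u"
proof -
  assume "u \<in> grp_gen M"
  then obtain a b where ab: "a \<in> M" "b \<in> M" "a * u = b" using grp_gen_fraction by blast
  then have "(qinv b * a) * u = 1" using qinv_left[OF qunit_M] by (simp add: mult.assoc)
  then show ?thesis unfolding qunit_def using mult_commute by metis
qed

lemma MinvL_iff: "x \<in> MinvL M L \<longleftrightarrow> (\<exists>a\<in>M. a * x \<in> L)"
proof
  assume "x \<in> MinvL M L"
  then obtain a y where "a \<in> M" "y \<in> L" "x = qinv a * y" by (auto simp: MinvL_def)
  then have "a * x = y" using qinv_right[OF qunit_M] by (simp add: mult.assoc[symmetric])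
  then show "\<exists>a\<in>M. a * x \<in> L" using \<open>a \<in> M\<close> \<open>y \<in> L\<close> by blast
next
  assume "\<exists>a\<in>M. a * x \<in> L"
  then obtain a where "a \<in> M" "a * x \<in> L" by blast
  moreover have "x = qinv a * (a * x)"
    using qinv_left[OF qunit_M, OF \<open>a \<in> M\<close>] by (simp add: mult.assoc[symmetric])
  ultimately show "x \<in> MinvL M L" unfolding MinvL_def by blast
qed

lemma grpG_mult:
  assumes "(b, u) \<in> grpG M L" "(c, v) \<in> grpG M L"
  shows "(b + u * c, u * v) \<in> grpG M L"
proof -
  from assms obtain a p q e where *: "a \<in> M" "a * b \<in> L" "p \<in> M" "q \<in> M" "p * u = q" "e \<in> M" "e * c \<in> L"
    unfolding grpG_def using MinvL_iff grp_gen_fraction[of u] by blast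
  \<comment> \<open>Common denominator: \<open>a\<close> clears \<open>b\<close>, \<open>p\<close>
    clears \<open>u\<close>, and \<open>e\<close> clears \<open>c\<close>.\<close>
  have "a * (p * e) * (b + u * c) = p * (e * (a * b)) + a * ((p * u) * (e * c))"
    by (simp add: distrib_left mult.assoc mult_left_commute)
  also have "\<dots> = p * (e * (a * b)) + a * (q * (e * c))" using * by simp
  also have "\<dots> \<in> L" using * L(4) by (intro add_subgroup_add[OF L(1)]) auto
  finally have "b + u * c \<in> MinvL M L" using * M_mult MinvL_iff by blast
  then show ?thesis using assms by (auto simp: grpG_def intro: grp_gen.mult)
qed

lemma translation_in_grpG: "b \<in> L \<Longrightarrow> (b, 1) \<in> grpG M L"
  and dilation_in_grpG: "a \<in> M \<Longrightarrow> (0, a) \<in> grpG M L"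
  using M_one add_subgroup_zero[OF L(1)]
  by (auto simp: grpG_def MinvL_iff intro: grp_gen.intros bexI[of _ 1])

text \<open>For \<open>a C\<close> the point is first divided by the unit \<open>a\<close>; for the
  preimage one multiple brings \<open>x\<close> into \<open>L\<close> and a further one brings
  \<open>a * x\<close> into \<open>C\<close>.\<close>

lemma constructible_full: "C \<in> constructible M L \<Longrightarrow> full_subgroup C"
proof (induction rule: constructible.induct)
  case base
  show ?case by (rule full_L)
next
  case (mul C a)
  have sub: "add_subgroup C" using mul by (simp add: full_subgroup_def)
  have "add_subgroup ((*) a ` C)"
    unfolding add_subgroup_def
  proof (intro conjI ballI)
    show "0 \<in> (*) a ` C" using add_subgroup_zero[OF sub] by (force intro: image_eqI[of _ _ 0])
    show "- x \<in> (*) a ` C" if "x \<in> (*) a ` C" for x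
      using that add_subgroup_minus[OF sub] by (force intro: image_eqI[of _ _ "- _"])
    show "x + y \<in> (*) a ` C" if "x \<in> (*) a ` C" "y \<in> (*) a ` C" for x y
      using that add_subgroup_add[OF sub] by (auto simp: distrib_left[symmetric])
  qed
  moreover have "\<exists>n::nat. n > 0 \<and> of_nat n * x \<in> (*) a ` C" for x
  proof -
    obtain n where n: "n > 0" "of_nat n * (qinv a * x) \<in> C"
      using mul full_subgroup_multiple by blast
    have "of_nat n * x = a * (of_nat n * (qinv a * x))"
      using qinv_right[OF qunit_M, OF \<open>a \<in> M\<close>]
      by (metis mult.assoc mult_1 mult_left_commute)
    then show ?thesis using n by blast
  qed
  ultimately show ?case unfolding full_subgroup_def by blast
next
  case (pre C a)
  have sub: "add_subgroup C" using pre by (simp add: full_subgroup_def)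
  have "add_subgroup {x \<in> L. a * x \<in> C}"
    using L(1) sub unfolding add_subgroup_def by (auto simp: distrib_left)
  moreover have "\<exists>n::nat. n > 0 \<and> of_nat n * x \<in> {x \<in> L. a * x \<in> C}" for x
  proof -
    obtain n where n: "n > 0" "of_nat n * x \<in> L" using full_L by (auto simp: full_subgroup_def)
    obtain m where m: "m > 0" "of_nat m * (a * (of_nat n * x)) \<in> C"
      using pre full_subgroup_multiple by blast
    have "of_nat (m * n) * x \<in> L" using n add_subgroup_of_nat[OF L(1)] by (simp add: mult.assoc)
    moreover have "a * (of_nat (m * n) * x) \<in> C"
      using m by (simp add: mult.assoc mult_left_commute[of a])
    ultimately show ?thesis using n m by (intro exI[of _ "m * n"]) simp
  qed
  ultimately show ?case unfolding full_subgroup_def by blast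
qed

text \<open>Some \<open>m\<close> multiplies all generators of \<open>R\<close> into
  \<open>C\<close>, so a coset depends only on coefficients modulo \<open>m\<close>, and these take
  finitely many values.\<close>

lemma finite_cosets:
  assumes C: "full_subgroup C"
  shows "finite (cosets L C)"
proof -
  obtain T where T: "finite T" "zspan T = R" using R(2) by (auto simp: fin_gen_def)
  obtain m where m: "m > 0" "\<forall>t\<in>T. of_nat m * t \<in> C"
    using full_subgroup_common_multiple[OF C T(1)] by blast
  have sub: "add_subgroup C" using C by (simp add: full_subgroup_def)
  define f where "f c = (\<lambda>h. (\<Sum>t\<in>T. of_int (c t) * t) + h) ` C" for c :: "'a \<Rightarrow> int"
  have "cosets L C \<subseteq> f ` (T \<rightarrow>\<^sub>E {0..<int m})"
  proof
    fix X assume "X \<in> cosets L C"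
    then obtain x where x: "x \<in> L" "X = (\<lambda>h. x + h) ` C" by (auto simp: cosets_def)
    obtain c where c: "x = (\<Sum>t\<in>T. of_int (c t) * t)"
      using x L(2) T(2) zspan_finite[OF T(1)] by auto
    \<comment> \<open>The reduced coefficients are \<open>undefined\<close> outside
      \<open>T\<close>, so that they belong to a finite extensional function space.\<close>
    define d where "d = restrict (\<lambda>t. c t mod int m) T"
    define z where "z = (\<Sum>t\<in>T. of_int (c t div int m) * (of_nat m * t))"
    have zC: "z \<in> C" unfolding z_def using m sub by (intro add_subgroup_sum add_subgroup_of_int) auto
    have "x = (\<Sum>t\<in>T. of_int (c t mod int m) * t) + z"
    proof -
      have "of_int (c t) * t = of_int (c t mod int m) * t + of_int (c t div int m) * (of_nat m * t)" for t
      proof -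
        have "(of_int (c t) :: 'a) = of_int (c t mod int m + c t div int m * int m)" by simp
        also have "\<dots> = of_int (c t mod int m) + of_int (c t div int m) * of_nat m"
          by (simp only: of_int_add of_int_mult of_int_of_nat_eq)
        finally show ?thesis by (simp add: distrib_right mult.assoc)
      qed
      then show ?thesis unfolding c z_def by (simp add: sum.distrib[symmetric])
    qed
    also have "(\<Sum>t\<in>T. of_int (c t mod int m) * t) = (\<Sum>t\<in>T. of_int (d t) * t)"
      by (intro sum.cong) (auto simp: d_def)
    finally have xz: "x = (\<Sum>t\<in>T. of_int (d t) * t) + z" .
    have "X = f d"
      unfolding x(2) f_def
    proof (intro equalityI subsetI)
      fix y assume "y \<in> (\<lambda>h. x + h) ` C"
      then obtain h where "h \<in> C" "y = x + h" by auto
      then show "y \<in> (\<lambda>h. (\<Sum>t\<in>T. of_int (d t) * t) + h) ` C"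
        using xz zC sub by (auto simp: add.assoc intro!: imageI add_subgroup_add)
    next
      fix y assume "y \<in> (\<lambda>h. (\<Sum>t\<in>T. of_int (d t) * t) + h) ` C"
      then obtain h where "h \<in> C" "y = x + (h - z)" using xz by auto
      then show "y \<in> (\<lambda>h. x + h) ` C" using zC sub by (auto intro!: imageI add_subgroup_diff)
    qed
    moreover have "d \<in> T \<rightarrow>\<^sub>E {0..<int m}" using m by (auto simp: d_def)
    ultimately show "X \<in> f ` (T \<rightarrow>\<^sub>E {0..<int m})" by blast
  qed
  then show ?thesis by (rule finite_subset) (intro finite_imageI finite_PiE; simp add: T(1))
qed

end

section \<open>The completed lattice and its partial action\<close>

lemma coset_eq_iff:
  fixes C :: "'a::ring_1 set"
  assumes C: "add_subgroup C"
  shows "(\<lambda>c. x + c) ` C = (\<lambda>c. y + c) ` C \<longleftrightarrow> x - y \<in> C"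
proof
  assume "(\<lambda>c. x + c) ` C = (\<lambda>c. y + c) ` C"
  moreover have "x \<in> (\<lambda>c. x + c) ` C" using add_subgroup_zero[OF C] by (force intro: image_eqI[of _ _ 0])
  ultimately show "x - y \<in> C" by auto
next
  assume xy: "x - y \<in> C"
  have "(\<lambda>c. z + c) ` C \<subseteq> (\<lambda>c. w + c) ` C" if "z - w \<in> C" for z w
  proof safe
    fix c assume "c \<in> C"
    then have "z + c = w + ((z - w) + c)" "(z - w) + c \<in> C" using that C by (auto simp: add_subgroup_add)
    then show "z + c \<in> (\<lambda>c. w + c) ` C" by blast
  qed
  moreover have "y - x \<in> C" using add_subgroup_minus[OF C xy] by simp
  ultimately show "(\<lambda>c. x + c) ` C = (\<lambda>c. y + c) ` C" using xy by blast
qed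

section \<open>Topology of the completion\<close>

context lattice_action
begin

abbreviation "\<C> \<equiv> constructible M L"
abbreviation "X \<equiv> Lbar_top M L"
abbreviation "\<iota> \<equiv> iota M L"

lemma constructible_subgroup: "C \<in> \<C> \<Longrightarrow> add_subgroup C"
  using constructible_full full_subgroup_def by blast

lemma topspace_X:
  "topspace X = {\<xi> \<in> Pi\<^sub>E \<C> (cosets L). \<forall>C\<in>\<C>. \<forall>D\<in>\<C>. C \<subseteq> D \<longrightarrow> \<xi> C \<subseteq> \<xi> D}"
  by (auto simp: Lbar_top_def)

lemma iota_topspace: "x \<in> L \<Longrightarrow> \<iota> x \<in> topspace X"
  unfolding topspace_X by (auto simp: iota_def cosets_def)

lemma iota_eq_iff: "C \<in> \<C> \<Longrightarrow> \<iota> x C = \<iota> y C \<longleftrightarrow> x - y \<in> C"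
  by (simp add: iota_def coset_eq_iff constructible_subgroup)

text \<open>Finite families of coordinates are used instead of single ones, since
  \<open>constructible\<close> has no rule for intersections.\<close>

lemma open_contains_cylinder:
  assumes "openin X U" "\<xi> \<in> U"
  shows "\<exists>F. finite F \<and> F \<subseteq> \<C> \<and> (\<forall>\<eta>\<in>topspace X. (\<forall>C\<in>F. \<eta> C = \<xi> C) \<longrightarrow> \<eta> \<in> U)"
proof -
  let ?P = "product_topology (\<lambda>C. discrete_topology (cosets L C)) \<C>"
  obtain V where V: "openin ?P V" "U = V \<inter> {\<xi>. \<forall>C\<in>\<C>. \<forall>D\<in>\<C>. C \<subseteq> D \<longrightarrow> \<xi> C \<subseteq> \<xi> D}"
    using assms(1) unfolding Lbar_top_def openin_subtopology by blast
  then have "\<xi> \<in> V" using assms(2) by blast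
  from bspec[OF V(1)[unfolded openin_product_topology_alt] this]
  obtain W where W': "finite {C \<in> \<C>. W C \<noteq> topspace (discrete_topology (cosets L C))}
      \<and> (\<forall>C\<in>\<C>. openin (discrete_topology (cosets L C)) (W C)) \<and> \<xi> \<in> Pi\<^sub>E \<C> W \<and> Pi\<^sub>E \<C> W \<subseteq> V"
    by (rule exE)
  then have W: "finite {C \<in> \<C>. W C \<noteq> cosets L C}" "\<xi> \<in> Pi\<^sub>E \<C> W" "Pi\<^sub>E \<C> W \<subseteq> V" by simp_all
  define F where "F = {C \<in> \<C>. W C \<noteq> cosets L C}"
  have "\<eta> \<in> U" if \<eta>: "\<eta> \<in> topspace X" "\<forall>C\<in>F. \<eta> C = \<xi> C" for \<eta>
  proof -
    have "\<eta> \<in> Pi\<^sub>E \<C> W"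
    proof (rule PiE_I)
      show "\<eta> C \<in> W C" if "C \<in> \<C>" for C
        using that \<eta> W(2) unfolding topspace_X by (cases "C \<in> F") (auto simp: F_def PiE_iff)
      show "\<eta> C = undefined" if "C \<notin> \<C>" for C
        using that \<eta> unfolding topspace_X by (auto simp: PiE_iff extensional_def)
    qed
    then have "\<eta> \<in> V" using W(3) by (rule rev_subsetD)
    then show ?thesis using V(2) \<eta>(1) unfolding topspace_X by simp
  qed
  moreover have "finite F" "F \<subseteq> \<C>" using W(1) by (auto simp: F_def)
  ultimately show ?thesis by (intro exI[of _ F]) simp
qed

lemma open_cylinder:
  assumes F: "finite F" "F \<subseteq> \<C>" and \<xi>: "\<xi> \<in> topspace X"
  shows "openin X {\<eta> \<in> topspace X. \<forall>C\<in>F. \<eta> C = \<xi> C}"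
proof -
  have *: "openin X {\<eta> \<in> topspace X. \<eta> C \<in> {\<xi> C}}" if C: "C \<in> \<C>" for C
  proof (rule openin_continuous_map_preimage[of X "discrete_topology (cosets L C)"])
    show "continuous_map X (discrete_topology (cosets L C)) (\<lambda>\<eta>. \<eta> C)"
      unfolding Lbar_top_def using C
      by (intro continuous_map_from_subtopology continuous_map_product_projection)
    show "openin (discrete_topology (cosets L C)) {\<xi> C}" using C \<xi> unfolding topspace_X by auto
  qed
  show ?thesis
    using F
  proof (induction F rule: finite_induct)
    case (insert C F)
    have "{\<eta> \<in> topspace X. \<forall>D\<in>insert C F. \<eta> D = \<xi> D}
        = {\<eta> \<in> topspace X. \<eta> C \<in> {\<xi> C}} \<inter> {\<eta> \<in> topspace X. \<forall>D\<in>F. \<eta> D = \<xi> D}" by auto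
    then show ?case using insert * by (simp add: openin_Int)
  qed simp
qed

text \<open>Reduces the closure in \<open>pdom\<close> to finding lattice points with finitely many
  prescribed coordinates.\<close>

lemma closure_iota_iff:
  assumes "S \<subseteq> L"
  shows "\<xi> \<in> X closure_of (\<iota> ` S) \<longleftrightarrow>
    \<xi> \<in> topspace X \<and> (\<forall>F. finite F \<and> F \<subseteq> \<C> \<longrightarrow> (\<exists>y\<in>S. \<forall>C\<in>F. \<iota> y C = \<xi> C))"
proof (intro iffI conjI allI impI; (elim conjE)?)
  assume cl: "\<xi> \<in> X closure_of (\<iota> ` S)"
  show \<xi>: "\<xi> \<in> topspace X" using cl by (simp add: in_closure_of)
  fix F assume F: "finite F" "F \<subseteq> \<C>"
  define V where "V = {\<eta> \<in> topspace X. \<forall>C\<in>F. \<eta> C = \<xi> C}"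
  have "\<xi> \<in> V" "openin X V" using \<xi> open_cylinder[OF F \<xi>] by (simp_all add: V_def)
  then have "\<exists>\<eta>. \<eta> \<in> \<iota> ` S \<and> \<eta> \<in> V" using cl unfolding in_closure_of by blast
  then show "\<exists>y\<in>S. \<forall>C\<in>F. \<iota> y C = \<xi> C" by (auto simp: V_def)
next
  assume \<xi>: "\<xi> \<in> topspace X"
    and approx: "\<forall>F. finite F \<and> F \<subseteq> \<C> \<longrightarrow> (\<exists>y\<in>S. \<forall>C\<in>F. \<iota> y C = \<xi> C)"
  show "\<xi> \<in> X closure_of (\<iota> ` S)"
    unfolding in_closure_of
  proof (intro conjI allI impI \<xi>)
    fix U assume "\<xi> \<in> U \<and> openin X U"
    then have U: "openin X U" "\<xi> \<in> U" by simp_all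
    obtain F where F: "finite F" "F \<subseteq> \<C>" "\<forall>\<eta>\<in>topspace X. (\<forall>C\<in>F. \<eta> C = \<xi> C) \<longrightarrow> \<eta> \<in> U"
      using open_contains_cylinder[OF U] by (elim exE conjE)
    then obtain y where y: "y \<in> S" "\<forall>C\<in>F. \<iota> y C = \<xi> C" using approx by blast
    then have "\<iota> y \<in> U" using bspec[OF F(3), of "\<iota> y"] iota_topspace assms by blast
    then show "\<exists>\<eta>. \<eta> \<in> \<iota> ` S \<and> \<eta> \<in> U" using y(1) by blast
  qed
qed

lemma Hausdorff_X: "Hausdorff_space X"
  unfolding Lbar_top_def
  by (intro Hausdorff_space_subtopology) (simp add: Hausdorff_space_product_topology)

text \<open>Tychonoff: the factors are finite and discrete, and the compatibility conditions cut out
  a closed subset.\<close>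

lemma compact_X: "compact_space X"
proof -
  let ?P = "product_topology (\<lambda>C. discrete_topology (cosets L C)) \<C>"
  let ?S = "{\<xi>. \<forall>C\<in>\<C>. \<forall>D\<in>\<C>. C \<subseteq> D \<longrightarrow> \<xi> C \<subseteq> \<xi> D}"
  have comp: "compact_space ?P"
    using finite_cosets constructible_full
    by (auto simp: compact_space_product_topology compact_space_discrete_topology)
  define K where "K C D = {\<xi> \<in> topspace ?P. \<xi> C \<subseteq> \<xi> D}" for C D
  have "closedin ?P (K C D)" if CD: "C \<in> \<C>" "D \<in> \<C>" for C D
  proof -
    have "openin ?P {\<xi> \<in> topspace ?P. \<xi> C \<in> {u} \<and> \<xi> D \<in> {v}}"
      if "u \<in> cosets L C" "v \<in> cosets L D" for u v
    proof -
      have "openin ?P {\<xi> \<in> topspace ?P. \<xi> B \<in> {w}}" if "B \<in> \<C>" "w \<in> cosets L B" for B w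
        using that
        by (intro openin_continuous_map_preimage[of ?P "discrete_topology (cosets L B)"]
            continuous_map_product_projection) auto
      from openin_Int[OF this[OF CD(1) that(1)] this[OF CD(2) that(2)]] show ?thesis
        by (rule back_subst[where P = "openin ?P"]) auto
    qed
    \<comment> \<open>A violation of \<open>\<xi> C \<subseteq> \<xi> D\<close> is visible in two
      coordinates, so the violating points form a union of open cylinders.\<close>
    then have "openin ?P (\<Union>(u, v)\<in>{(u, v). u \<in> cosets L C \<and> v \<in> cosets L D \<and> \<not> u \<subseteq> v}.
        {\<xi> \<in> topspace ?P. \<xi> C \<in> {u} \<and> \<xi> D \<in> {v}})"
      by (intro openin_Union) auto
    also have "\<dots> = topspace ?P - K C D"
      using CD by (auto simp: K_def PiE_iff simp del: topspace_product_topology) (auto simp: PiE_iff)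
    finally show ?thesis by (auto simp: closedin_def K_def)
  qed
  \<comment> \<open>Inserting the whole space makes the family visibly nonempty, as an intersection
    of closed sets requires.\<close>
  then have closed: "closedin ?P (\<Inter>(insert (topspace ?P) {K C D |C D. C \<in> \<C> \<and> D \<in> \<C> \<and> C \<subseteq> D}))"
    by (intro closedin_Inter) (auto simp del: topspace_product_topology)
  have "\<Inter>(insert (topspace ?P) {K C D |C D. C \<in> \<C> \<and> D \<in> \<C> \<and> C \<subseteq> D}) = topspace ?P \<inter> ?S"
    unfolding K_def by blast
  then have "compactin ?P (topspace ?P \<inter> ?S)"
    using closedin_compact_space[OF comp closed] by simp
  then have "compact_space (subtopology ?P (topspace ?P \<inter> ?S))"
    by (simp add: compact_space_subtopology)
  then show ?thesis unfolding Lbar_top_def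
    by (metis subtopology_restrict)
qed

text \<open>Finitely many cylinders on whose traces \<open>f\<close> is constant cover the compact
  set \<open>K\<close>; the coordinates they involve together determine \<open>f\<close>.\<close>

lemma locally_constant_factors:
  assumes K: "closedin X K"
    and loc: "\<And>\<xi>. \<xi> \<in> K \<Longrightarrow> \<exists>U. openin X U \<and> \<xi> \<in> U \<and> (\<forall>\<eta>\<in>U \<inter> K. f \<eta> = f \<xi>)"
  shows "\<exists>F. finite F \<and> F \<subseteq> \<C> \<and> (\<forall>\<xi>\<in>K. \<forall>\<eta>\<in>K. (\<forall>C\<in>F. \<xi> C = \<eta> C) \<longrightarrow> f \<xi> = f \<eta>)"
proof -
  have KX: "K \<subseteq> topspace X" using K by (rule closedin_subset)
  have "\<exists>F. finite F \<and> F \<subseteq> \<C> \<and> (\<forall>\<eta>\<in>K. (\<forall>C\<in>F. \<eta> C = \<xi> C) \<longrightarrow> f \<eta> = f \<xi>)" if \<xi>: "\<xi> \<in> K" for \<xi>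
  proof -
    obtain U where U: "openin X U" "\<xi> \<in> U" "\<forall>\<eta>\<in>U \<inter> K. f \<eta> = f \<xi>" using loc[OF \<xi>] by blast
    obtain F where F: "finite F" "F \<subseteq> \<C>" "\<forall>\<eta>\<in>topspace X. (\<forall>C\<in>F. \<eta> C = \<xi> C) \<longrightarrow> \<eta> \<in> U"
      using open_contains_cylinder[OF U(1,2)] by (elim exE conjE)
    have "f \<eta> = f \<xi>" if "\<eta> \<in> K" "\<forall>C\<in>F. \<eta> C = \<xi> C" for \<eta>
      using that F(3) U(3) KX by auto
    then show ?thesis using F(1,2) by (intro exI[of _ F]) simp
  qed
  then obtain F where F: "\<And>\<xi>. \<xi> \<in> K \<Longrightarrow> finite (F \<xi>)" "\<And>\<xi>. \<xi> \<in> K \<Longrightarrow> F \<xi> \<subseteq> \<C>"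
    "\<And>\<xi> \<eta>. \<xi> \<in> K \<Longrightarrow> \<eta> \<in> K \<Longrightarrow> \<forall>C\<in>F \<xi>. \<eta> C = \<xi> C \<Longrightarrow> f \<eta> = f \<xi>"
    by metis
  define cyl where "cyl \<xi> = {\<eta> \<in> topspace X. \<forall>C\<in>F \<xi>. \<eta> C = \<xi> C}" for \<xi>
  have "compactin X K" using compact_X K by (rule closedin_compact_space)
  moreover have "\<forall>U\<in>cyl ` K. openin X U"
    unfolding cyl_def using F KX by (auto intro!: open_cylinder)
  moreover have "K \<subseteq> \<Union>(cyl ` K)" unfolding cyl_def using KX by blast
  ultimately obtain V where V: "finite V" "V \<subseteq> cyl ` K" "K \<subseteq> \<Union>V"
    unfolding compactin_def by meson
  then obtain J where J: "finite J" "J \<subseteq> K" "V = cyl ` J"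
    by (meson finite_subset_image)
  have "f \<xi> = f \<eta>" if *: "\<xi> \<in> K" "\<eta> \<in> K" "\<forall>C\<in>\<Union>(F ` J). \<xi> C = \<eta> C" for \<xi> \<eta>
  proof -
    obtain \<zeta> where \<zeta>: "\<zeta> \<in> J" "\<xi> \<in> cyl \<zeta>" using V(3) J(3) *(1) by auto
    then have "\<forall>C\<in>F \<zeta>. \<xi> C = \<zeta> C" "\<forall>C\<in>F \<zeta>. \<eta> C = \<zeta> C" using *(3) by (auto simp: cyl_def)
    then show ?thesis using F(3)[of \<zeta>] * \<zeta>(1) J(2) by (metis subsetD)
  qed
  moreover have "finite (\<Union>(F ` J))" "\<Union>(F ` J) \<subseteq> \<C>" using J F by auto
  ultimately show ?thesis by blast
qed

text \<open>Uniform continuity of affine maps: a linear part \<open>q / p\<close> maps the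
  constructible subgroup of all \<open>x\<close> with \<open>q * x\<close> in \<open>p D\<close>
  into \<open>D\<close>.\<close>

lemma act_modulus:
  assumes h: "h \<in> grpG M L" and D: "D \<in> \<C>"
  shows "\<exists>E\<in>\<C>. \<forall>y\<in>dom0 L h. \<forall>z\<in>dom0 L h. \<iota> y E = \<iota> z E \<longrightarrow> \<iota> (act h y) D = \<iota> (act h z) D"
proof -
  obtain p q where pq: "p \<in> M" "q \<in> M" "p * snd h = q"
    using h grp_gen_fraction[of "snd h"] by (auto simp: grpG_def)
  define E where "E = {x \<in> L. q * x \<in> (*) p ` D}"
  have E: "E \<in> \<C>" unfolding E_def using D pq by (intro constructible.pre constructible.mul)
  have "act h y - act h z \<in> D" if yz: "y - z \<in> E" for y z
  proof -
    have eq: "act h y - act h z = snd h * (y - z)" by (simp add: act_def right_diff_distrib)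
    obtain d where "d \<in> D" "q * (y - z) = p * d" using yz by (auto simp: E_def)
    then have "p * (snd h * (y - z)) = p * d" using pq(3) by (simp add: mult.assoc[symmetric])
    then show ?thesis using \<open>d \<in> D\<close> eq qunit_cancel[OF qunit_M[OF pq(1)]] by simp
  qed
  then show ?thesis using E D by (intro bexI[OF _ E]) (simp add: iota_eq_iff)
qed

section \<open>Partial action on the completion\<close>

lemma pdom_approx:
  assumes "\<xi> \<in> pdom M L h" "finite F" "F \<subseteq> \<C>"
  shows "\<exists>y\<in>dom0 L h. \<forall>C\<in>F. \<iota> y C = \<xi> C"
  using assms closure_iota_iff[of "dom0 L h" \<xi>] by (auto simp: pdom_def dom0_def)

text \<open>Makes the limit in \<open>theta\<close> usable: each of its coordinates is that of
  \<open>act h y\<close> for any \<open>y\<close> close enough to \<open>\<xi>\<close>.\<close>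

lemma theta_extends:
  assumes h: "h \<in> grpG M L" and \<xi>: "\<xi> \<in> pdom M L h"
  shows "theta M L h \<xi> \<in> topspace X"
    and "D \<in> \<C> \<Longrightarrow> \<exists>E\<in>\<C>. \<forall>y\<in>dom0 L h. \<iota> y E = \<xi> E \<longrightarrow> \<iota> (act h y) D = theta M L h \<xi> D"
proof -
  have \<xi>X: "\<xi> \<in> topspace X" using \<xi> closure_of_subset_topspace by (fastforce simp: pdom_def)
  obtain E where E: "\<And>D. D \<in> \<C> \<Longrightarrow> E D \<in> \<C>"
    "\<And>D y z. D \<in> \<C> \<Longrightarrow> y \<in> dom0 L h \<Longrightarrow> z \<in> dom0 L h \<Longrightarrow> \<iota> y (E D) = \<iota> z (E D)
      \<Longrightarrow> \<iota> (act h y) D = \<iota> (act h z) D"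
    using act_modulus[OF h] by metis
  have "\<exists>y\<in>dom0 L h. \<iota> y (E D) = \<xi> (E D)" if "D \<in> \<C>" for D
    using pdom_approx[OF \<xi>, of "{E D}"] E(1)[OF that] by auto
  then obtain Y where Y: "\<And>D. D \<in> \<C> \<Longrightarrow> Y D \<in> dom0 L h \<and> \<iota> (Y D) (E D) = \<xi> (E D)"
    by metis
  \<comment> \<open>One approximant \<open>Y D\<close> per coordinate defines the candidate;
    \<open>act_modulus\<close> makes it independent of the choice. Outside \<open>\<C>\<close> the
    value has to be \<open>undefined\<close>.\<close>
  define \<eta> where "\<eta> = restrict (\<lambda>D. \<iota> (act h (Y D)) D) \<C>"
  have \<eta>: "\<iota> (act h y) D = \<eta> D" if "D \<in> \<C>" "y \<in> dom0 L h" "\<iota> y (E D) = \<xi> (E D)" for y D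
    using that Y[of D] E(2)[of D y "Y D"] by (simp add: \<eta>_def)
  have \<eta>X: "\<eta> \<in> topspace X"
    unfolding topspace_X
  proof (intro CollectI conjI ballI impI)
    show "\<eta> \<in> Pi\<^sub>E \<C> (cosets L)"
      using Y by (auto simp: \<eta>_def iota_def cosets_def dom0_def)
    fix C D assume CD: "C \<in> \<C>" "D \<in> \<C>" "C \<subseteq> D"
    \<comment> \<open>Comparing two coordinates needs one approximant that serves both.\<close>
    obtain y where y: "y \<in> dom0 L h" "\<forall>B\<in>{E C, E D}. \<iota> y B = \<xi> B"
      using pdom_approx[OF \<xi>, of "{E C, E D}"] E(1) CD by auto
    then have "\<eta> C = \<iota> (act h y) C" "\<eta> D = \<iota> (act h y) D" using \<eta> CD by auto
    then show "\<eta> C \<subseteq> \<eta> D" using CD by (auto simp: iota_def)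
  qed
  define \<F> where "\<F> = inf (filtercomap \<iota> (nhdsin X \<xi>)) (principal (dom0 L h))"
  have ev: "eventually P \<F> \<longleftrightarrow> (\<exists>U. openin X U \<and> \<xi> \<in> U \<and> (\<forall>y\<in>dom0 L h. \<iota> y \<in> U \<longrightarrow> P y))"
    (is "_ \<longleftrightarrow> ?R") for P
  proof
    assume "eventually P \<F>"
    then obtain Q where Q: "eventually Q (nhdsin X \<xi>)" "\<And>y. Q (\<iota> y) \<Longrightarrow> y \<in> dom0 L h \<Longrightarrow> P y"
      unfolding \<F>_def eventually_inf_principal eventually_filtercomap by blast
    then obtain U where "openin X U" "\<xi> \<in> U" "\<forall>\<zeta>\<in>U. Q \<zeta>"
      using \<xi>X unfolding eventually_nhdsin by blast
    then show ?R using Q(2) by (intro exI[of _ U]) simp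
  next
    assume ?R
    then obtain U where U: "openin X U" "\<xi> \<in> U" "\<forall>y\<in>dom0 L h. \<iota> y \<in> U \<longrightarrow> P y" by blast
    then have "eventually (\<lambda>\<zeta>. \<zeta> \<in> U) (nhdsin X \<xi>)" unfolding eventually_nhdsin by blast
    then show "eventually P \<F>"
      unfolding \<F>_def eventually_inf_principal eventually_filtercomap
      using U(3) by (intro exI[of _ "\<lambda>\<zeta>. \<zeta> \<in> U"]) simp
  qed
  have lim: "limitin X (\<lambda>y. \<iota> (act h y)) \<eta> \<F>"
    unfolding limitin_def
  proof (intro conjI allI impI \<eta>X)
    fix U assume "openin X U \<and> \<eta> \<in> U"
    then have U: "openin X U" "\<eta> \<in> U" by simp_all
    obtain F where F: "finite F" "F \<subseteq> \<C>" "\<forall>\<zeta>\<in>topspace X. (\<forall>C\<in>F. \<zeta> C = \<eta> C) \<longrightarrow> \<zeta> \<in> U"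
      using open_contains_cylinder[OF U] by (elim exE conjE)
    define V where "V = {\<zeta> \<in> topspace X. \<forall>C\<in>E ` F. \<zeta> C = \<xi> C}"
    have "openin X V" unfolding V_def using F E(1) \<xi>X by (intro open_cylinder) auto
    moreover have "\<xi> \<in> V" using \<xi>X by (simp add: V_def)
    moreover have "\<iota> (act h y) \<in> U" if "y \<in> dom0 L h" "\<iota> y \<in> V" for y
    proof -
      have "\<iota> (act h y) \<in> topspace X" using that(1) by (auto simp: dom0_def intro: iota_topspace)
      moreover have "\<forall>C\<in>F. \<iota> (act h y) C = \<eta> C"
        using that F(2) unfolding V_def by (intro ballI \<eta>) auto
      ultimately show ?thesis using bspec[OF F(3)] by simp
    qed
    ultimately show "eventually (\<lambda>y. \<iota> (act h y) \<in> U) \<F>" unfolding ev by (intro exI[of _ V]) simp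
  qed
  \<comment> \<open>Uniqueness of limits needs a proper filter; it is proper because
    \<open>\<xi>\<close> lies in the closure defining \<open>pdom\<close>.\<close>
  have nontriv: "\<F> \<noteq> bot"
  proof
    assume "\<F> = bot"
    then have "eventually (\<lambda>_. False) \<F>" by simp
    then obtain U where U: "openin X U" "\<xi> \<in> U" "\<forall>y\<in>dom0 L h. \<iota> y \<notin> U" unfolding ev by auto
    then have "\<exists>\<eta>. \<eta> \<in> \<iota> ` dom0 L h \<and> \<eta> \<in> U" using \<xi> unfolding pdom_def in_closure_of by blast
    then show False using U(3) by auto
  qed
  have "theta M L h \<xi> = \<eta>"
    unfolding theta_def \<F>_def[symmetric]
    using lim limitin_Hausdorff_unique[OF _ lim nontriv Hausdorff_X] by (rule the_equality)
  then show "theta M L h \<xi> \<in> topspace X"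
    "D \<in> \<C> \<Longrightarrow> \<exists>E\<in>\<C>. \<forall>y\<in>dom0 L h. \<iota> y E = \<xi> E \<longrightarrow> \<iota> (act h y) D = theta M L h \<xi> D"
    using \<eta>X \<eta>[of D] E(1)[of D] by (simp_all) (intro bexI[of _ "E D"]; simp)
qed

lemma iota_pdom: "x \<in> dom0 L h \<Longrightarrow> \<iota> x \<in> pdom M L h"
  unfolding pdom_def using closure_of_subset[of "\<iota> ` dom0 L h" X] iota_topspace
  by (auto simp: dom0_def image_subset_iff)

lemma theta_iota:
  assumes h: "h \<in> grpG M L" and x: "x \<in> dom0 L h"
  shows "theta M L h (\<iota> x) = \<iota> (act h x)"
proof
  fix D
  note th = theta_extends[OF h iota_pdom[OF x]]
  show "theta M L h (\<iota> x) D = \<iota> (act h x) D"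
  proof (cases "D \<in> \<C>")
    case True
    then show ?thesis using th(2)[of D] x by auto
  next
    case False
    then show ?thesis using th(1) by (auto simp: topspace_X iota_def PiE_iff extensional_def)
  qed
qed

text \<open>Needed to transport composition to the inverse morphism. If \<open>y\<close>
  approximates \<open>\<xi>\<close>, then \<open>act (c, v) y\<close> differs from a point of
  \<open>dom0 L (b, u)\<close> by an element that \<open>u\<close> maps into \<open>L\<close>, so
  the composite is defined at \<open>y\<close>.\<close>

lemma gpd_comp_closed:
  assumes "\<gamma> \<in> gpd_arrows M L" "\<delta> \<in> gpd_arrows M L" "gpd_src \<gamma> = gpd_rng M L \<delta>"
  shows "gpd_comp \<gamma> \<delta> \<in> gpd_arrows M L"
proof -
  obtain b u \<eta> where \<gamma>: "\<gamma> = ((b, u), \<eta>)" by (metis prod.exhaust)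
  obtain c v \<xi> where \<delta>: "\<delta> = ((c, v), \<xi>)" by (metis prod.exhaust)
  have g: "(b, u) \<in> grpG M L" "\<eta> \<in> pdom M L (b, u)" and h: "(c, v) \<in> grpG M L" "\<xi> \<in> pdom M L (c, v)"
    and \<eta>: "\<eta> = theta M L (c, v) \<xi>"
    using assms by (auto simp: \<gamma> \<delta> gpd_arrows_def gpd_src_def gpd_rng_def)
  define k where "k = (b + u * c, u * v)"
  have act_k: "act k y = act (b, u) (act (c, v) y)" for y
    by (simp add: act_def k_def distrib_left mult.assoc add.assoc)
  obtain p q where pq: "p \<in> M" "q \<in> M" "p * u = q"
    using g(1) grp_gen_fraction[of u] by (auto simp: grpG_def)
  define D where "D = {x \<in> L. q * x \<in> (*) p ` L}"
  have D: "D \<in> \<C>" unfolding D_def using pq by (intro constructible.intros)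
  have uD: "u * x \<in> L" if x: "x \<in> D" for x
  proof -
    obtain l where "l \<in> L" "q * x = p * l" using x by (auto simp: D_def)
    then have "p * (u * x) = p * l" using pq(3) by (simp add: mult.assoc[symmetric])
    then show ?thesis using \<open>l \<in> L\<close> qunit_cancel[OF qunit_M[OF pq(1)]] by simp
  qed
  obtain x0 where x0: "x0 \<in> dom0 L (b, u)" "\<iota> x0 D = \<eta> D"
    using pdom_approx[OF g(2), of "{D}"] D by auto
  obtain B where B: "B \<in> \<C>" "\<forall>y\<in>dom0 L (c, v). \<iota> y B = \<xi> B \<longrightarrow> \<iota> (act (c, v) y) D = \<eta> D"
    using theta_extends(2)[OF h D] \<eta> by blast
  have "\<xi> \<in> pdom M L k"
    unfolding pdom_def
  proof (subst closure_iota_iff; (intro conjI allI impI)?)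
    show "dom0 L k \<subseteq> L" by (auto simp: dom0_def)
    show "\<xi> \<in> topspace X" using h(2) closure_of_subset_topspace by (fastforce simp: pdom_def)
    fix F assume F: "finite F \<and> F \<subseteq> \<C>"
    then obtain y where y: "y \<in> dom0 L (c, v)" "\<forall>C\<in>insert B F. \<iota> y C = \<xi> C"
      using pdom_approx[OF h(2), of "insert B F"] B(1) by blast
    then have "\<iota> (act (c, v) y) D = \<iota> x0 D" using B(2) x0(2) by simp
    then have "act (c, v) y - x0 \<in> D" using D by (simp add: iota_eq_iff)
    then have "act (b, u) x0 + u * (act (c, v) y - x0) \<in> L"
      using x0(1) uD by (intro add_subgroup_add[OF L(1)]) (auto simp: dom0_def)
    then have "act k y \<in> L" unfolding act_k by (simp add: act_def algebra_simps)
    then have "y \<in> dom0 L k" using y(1) by (simp add: dom0_def)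
    then show "\<exists>y\<in>dom0 L k. \<forall>C\<in>F. \<iota> y C = \<xi> C" using y(2) by auto
  qed
  then show ?thesis
    using grpG_mult[OF g(1) h(1)] by (simp add: gpd_arrows_def gpd_comp_def \<gamma> \<delta> k_def)
qed

end

section \<open>Rational extension of additive maps\<close>

context lattice_action
begin

lemma fin_gen_L: "fin_gen L"
  using R(2) L(1,2) fin_gen_subgroup by (metis fin_gen_def)

text \<open>Here \<open>'a\<close> is the target, where division by \<open>n\<close> is possible:
  \<open>\<alpha> x\<close> is \<open>f (n x) / n\<close> for any \<open>n > 0\<close> with
  \<open>n x\<close> in \<open>N\<close>, and two choices of \<open>n\<close> are compared at their
  product.\<close>

lemma extend_additive:
  fixes f :: "'b::ring_1 \<Rightarrow> 'a"
  assumes N: "full_subgroup N" and f: "\<And>x y. x \<in> N \<Longrightarrow> y \<in> N \<Longrightarrow> f (x + y) = f x + f y"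
  shows "\<exists>\<alpha>. (\<forall>x y. \<alpha> (x + y) = \<alpha> x + \<alpha> y) \<and> (\<forall>x\<in>N. \<alpha> x = f x)"
proof -
  have sub: "add_subgroup N" using N by (simp add: full_subgroup_def)
  have f0: "f 0 = 0" using f[of 0 0] add_subgroup_zero[OF sub] by simp
  have fn: "f (of_nat k * x) = of_nat k * f x" if "x \<in> N" for k x
    by (induction k) (use that in \<open>simp_all add: f0 distrib_right f add_subgroup_of_nat[OF sub]\<close>)
  define P where "P x y \<longleftrightarrow> (\<exists>n::nat. n > 0 \<and> of_nat n * x \<in> N \<and> of_nat n * y = f (of_nat n * x))" for x y
  have "\<exists>y. P x y" for x
  proof -
    obtain n where n: "n > 0" "of_nat n * x \<in> N" using full_subgroup_multiple[OF N] .
    then show ?thesis using of_nat_divide[OF n(1)] unfolding P_def by blast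
  qed
  then obtain \<alpha> where "\<And>x. P x (\<alpha> x)" by metis
  have \<alpha>: "of_nat n * \<alpha> x = f (of_nat n * x)" if n: "n > 0" "of_nat n * x \<in> N" for n x
  proof -
    obtain m where m: "m > 0" "of_nat m * x \<in> N" "of_nat m * \<alpha> x = f (of_nat m * x)"
      using \<open>P x (\<alpha> x)\<close> unfolding P_def by blast
    have comm: "of_nat m * (of_nat n * z) = of_nat n * (of_nat m * z)" for z :: "'c::ring_1"
      by (metis mult.commute mult.assoc of_nat_mult)
    have "of_nat m * (of_nat n * \<alpha> x) = of_nat n * f (of_nat m * x)" using m(3) comm by metis
    also have "\<dots> = f (of_nat n * (of_nat m * x))" using fn[OF m(2)] by simp
    also have "\<dots> = f (of_nat m * (of_nat n * x))" using comm by metis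
    also have "\<dots> = of_nat m * f (of_nat n * x)" using fn[OF n(2)] by simp
    finally show ?thesis using of_nat_cancel[OF m(1)] by blast
  qed
  have "\<alpha> (x + y) = \<alpha> x + \<alpha> y" for x y
  proof -
    obtain n where n: "n > 0" "of_nat n * x \<in> N" "of_nat n * y \<in> N"
      using full_subgroup_common_multiple[OF N, of "{x, y}"] by auto
    then have "of_nat n * (x + y) \<in> N" using add_subgroup_add[OF sub] by (simp add: distrib_left)
    then have "of_nat n * \<alpha> (x + y) = f (of_nat n * x + of_nat n * y)"
      using \<alpha> n(1) by (simp add: distrib_left)
    also have "\<dots> = of_nat n * (\<alpha> x + \<alpha> y)" using f n \<alpha> by (simp add: distrib_left)
    finally show ?thesis using of_nat_cancel[OF n(1)] by blast
  qed
  moreover have "\<forall>x\<in>N. \<alpha> x = f x" using \<alpha>[of 1] by simp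
  ultimately show ?thesis by (intro exI[of _ \<alpha>]) simp
qed

lemma topspace_gpd_top: "topspace (gpd_top M L) = gpd_arrows M L"
  using closure_of_subset_topspace[of X]
  by (fastforce simp: gpd_top_def gpd_arrows_def pdom_def)

lemma dom0_translation: "b \<in> L \<Longrightarrow> dom0 L (b, 1) = L"
  and dom0_dilation: "a \<in> M \<Longrightarrow> dom0 L (0, a) = L"
  using L(1,4) by (auto simp: dom0_def act_def add_subgroup_add)

end

section \<open>The cocycle of a groupoid morphism\<close>

text \<open>The semidirect product, that is, composition of the affine maps \<open>act\<close>; it
  is the group component of \<open>gpd_comp\<close>.\<close>

definition gmult :: "'a::ring_1 \<times> 'a \<Rightarrow> 'a \<times> 'a \<Rightarrow> 'a \<times> 'a" where
  "gmult g h = (fst g + snd g * fst h, snd g * snd h)"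

text \<open>Interpreted both for the given isomorphism and for its inverse.\<close>

locale action_morphism =
  A: lattice_action R1 M1 L1 + B: lattice_action R2 M2 L2
  for R1 M1 L1 :: "'a::ring_1 set" and R2 M2 L2 :: "'b::ring_1 set" +
  fixes \<Phi> :: "('a \<times> 'a) \<times> ('a set \<Rightarrow> 'a set) \<Rightarrow> ('b \<times> 'b) \<times> ('b set \<Rightarrow> 'b set)"
  assumes inj_Phi: "inj_on \<Phi> (gpd_arrows M1 L1)"
    and Phi_arrows: "\<gamma> \<in> gpd_arrows M1 L1 \<Longrightarrow> \<Phi> \<gamma> \<in> gpd_arrows M2 L2"
    and cont_Phi: "continuous_map (gpd_top M1 L1) (gpd_top M2 L2) \<Phi>"
    and Phi_comp: "\<gamma> \<in> gpd_arrows M1 L1 \<Longrightarrow> \<delta> \<in> gpd_arrows M1 L1 \<Longrightarrow> gpd_src \<gamma> = gpd_rng M1 L1 \<delta>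
      \<Longrightarrow> \<Phi> (gpd_comp \<gamma> \<delta>) = gpd_comp (\<Phi> \<gamma>) (\<Phi> \<delta>)"
begin

text \<open>Evaluated at lattice points only, where \<open>theta\<close> is the affine
  action.\<close>

definition cocycle :: "'a \<times> 'a \<Rightarrow> 'a \<Rightarrow> 'b \<times> 'b" where
  "cocycle g x = fst (\<Phi> (g, A.\<iota> x))"

section \<open>Cocycle identities\<close>

lemma arrowI: "g \<in> grpG M1 L1 \<Longrightarrow> x \<in> dom0 L1 g \<Longrightarrow> (g, A.\<iota> x) \<in> gpd_arrows M1 L1"
  by (simp add: gpd_arrows_def A.iota_pdom)

lemma cocycle_grpG: "g \<in> grpG M1 L1 \<Longrightarrow> x \<in> dom0 L1 g \<Longrightarrow> cocycle g x \<in> grpG M2 L2"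
  using Phi_arrows[OF arrowI, of g x] by (auto simp: cocycle_def gpd_arrows_def)

lemma qunit_cocycle: "g \<in> grpG M1 L1 \<Longrightarrow> x \<in> dom0 L1 g \<Longrightarrow> qunit (snd (cocycle g x))"
  using cocycle_grpG[of g x] B.qunit_grp_gen by (auto simp: grpG_def)

text \<open>Besides the cocycle identity this records that composing on the left keeps the source of
  the image arrow, which later lets injectivity of \<open>\<Phi>\<close> be applied.\<close>

lemma Phi_gmult:
  assumes "g \<in> grpG M1 L1" "h \<in> grpG M1 L1" "x \<in> dom0 L1 h" "act h x \<in> dom0 L1 g"
  shows "\<Phi> (gmult g h, A.\<iota> x) = (gmult (cocycle g (act h x)) (cocycle h x), snd (\<Phi> (h, A.\<iota> x)))"
  using Phi_comp[OF arrowI[OF assms(1,4)] arrowI[OF assms(2,3)]] A.theta_iota[OF assms(2,3)]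
  by (simp add: gpd_src_def gpd_rng_def gpd_comp_def gmult_def cocycle_def)

lemma cocycle_gmult:
  assumes "g \<in> grpG M1 L1" "h \<in> grpG M1 L1" "x \<in> dom0 L1 h" "act h x \<in> dom0 L1 g"
  shows "cocycle (gmult g h) x = gmult (cocycle g (act h x)) (cocycle h x)"
  unfolding cocycle_def[of "gmult g h"] using Phi_gmult[OF assms] by simp

lemma gmult_cancel_right:
  fixes g h k :: "'b \<times> 'b"
  assumes "gmult g k = gmult h k" "qunit (snd k)"
  shows "g = h"
proof -
  have "snd k * snd g = snd k * snd h"
    using assms(1) B.mult_commute by (metis gmult_def snd_conv)
  then have "snd g = snd h" using qunit_cancel assms(2) by blast
  then show ?thesis using assms(1) by (simp add: gmult_def prod_eq_iff)
qed

lemma gmult_one: "gmult (0, 1) g = g"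
  by (simp add: gmult_def)

lemma zero_in_L: "0 \<in> L1"
  using A.L(1) by (rule add_subgroup_zero)

text \<open>The identity is idempotent, so its value is idempotent and one factor cancels.\<close>

lemma cocycle_one:
  assumes "x \<in> L1"
  shows "cocycle (0, 1) x = (0, 1)"
proof (rule gmult_cancel_right[of _ "cocycle (0, 1) x"])
  note * = A.translation_in_grpG[OF zero_in_L] A.dom0_translation[OF zero_in_L]
  show "gmult (cocycle (0, 1) x) (cocycle (0, 1) x) = gmult (0, 1) (cocycle (0, 1) x)"
    using cocycle_gmult[of "(0, 1)" "(0, 1)" x] * assms by (simp add: gmult_one act_def)
  show "qunit (snd (cocycle (0, 1) x))" using * assms by (intro qunit_cocycle) auto
qed

lemma cocycle_translation_add:
  assumes "b \<in> L1" "d \<in> L1" "x \<in> L1"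
  shows "cocycle (b + d, 1) x = gmult (cocycle (b, 1) (d + x)) (cocycle (d, 1) x)"
  using cocycle_gmult[of "(b, 1)" "(d, 1)" x] assms
  by (simp add: A.translation_in_grpG A.dom0_translation act_def gmult_def add_subgroup_add A.L(1))

text \<open>The images of \<open>(b, 1)\<close> and \<open>(0, 1)\<close> at
  \<open>\<iota> 0\<close> have the same source by \<open>Phi_gmult\<close> and, by assumption, the
  same group component, so injectivity identifies the two arrows.\<close>

lemma cocycle_translation_trivial:
  assumes b: "b \<in> L1" and triv: "cocycle (b, 1) 0 = (0, 1)"
  shows "b = 0"
proof -
  note * = A.translation_in_grpG A.dom0_translation zero_in_L b
  have one: "gmult (b, 1) (0, 1) = (b, 1)" by (simp add: gmult_def)
  have "snd (\<Phi> ((b, 1), A.\<iota> 0)) = snd (\<Phi> ((0, 1), A.\<iota> 0))"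
    using Phi_gmult[of "(b, 1)" "(0, 1)" 0] * unfolding one by (simp add: act_def)
  moreover have "fst (\<Phi> ((b, 1), A.\<iota> 0)) = fst (\<Phi> ((0, 1), A.\<iota> 0))"
    using triv cocycle_one[OF zero_in_L] by (simp add: cocycle_def)
  ultimately have "\<Phi> ((b, 1), A.\<iota> 0) = \<Phi> ((0, 1), A.\<iota> 0)" by (rule prod_eqI[rotated])
  then have "((b, 1), A.\<iota> 0) = ((0, 1), A.\<iota> 0)"
    using inj_onD[OF inj_Phi] arrowI * by blast
  then show ?thesis by simp
qed

text \<open>Because the group is discrete, the arrows with group component \<open>v\<close> form an
  open set; its preimage contains a neighbourhood of \<open>\<xi>\<close> at fixed
  \<open>g\<close>.\<close>

lemma cocycle_locally_constant:
  assumes g: "g \<in> grpG M1 L1" and \<xi>: "\<xi> \<in> pdom M1 L1 g"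
  shows "\<exists>V. openin A.X V \<and> \<xi> \<in> V \<and> (\<forall>\<eta>\<in>V \<inter> pdom M1 L1 g. fst (\<Phi> (g, \<eta>)) = fst (\<Phi> (g, \<xi>)))"
proof -
  have arr: "(g, \<xi>) \<in> gpd_arrows M1 L1" using g \<xi> by (simp add: gpd_arrows_def)
  define v where "v = fst (\<Phi> (g, \<xi>))"
  have v: "v \<in> grpG M2 L2" using Phi_arrows[OF arr] by (auto simp: v_def gpd_arrows_def)
  define W where "W = ({v} \<times> topspace B.X) \<inter> gpd_arrows M2 L2"
  have "openin (prod_topology (discrete_topology (grpG M2 L2)) B.X) ({v} \<times> topspace B.X)"
    using v by (simp add: openin_prod_Times_iff)
  then have "openin (gpd_top M2 L2) W"
    unfolding gpd_top_def W_def by (rule openin_subtopology_Int)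
  then have "openin (gpd_top M1 L1) {\<gamma> \<in> topspace (gpd_top M1 L1). \<Phi> \<gamma> \<in> W}"
    using cont_Phi by (rule openin_continuous_map_preimage[rotated])
  then obtain T where T: "openin (prod_topology (discrete_topology (grpG M1 L1)) A.X) T"
    "{\<gamma> \<in> gpd_arrows M1 L1. \<Phi> \<gamma> \<in> W} = T \<inter> gpd_arrows M1 L1"
    unfolding A.topspace_gpd_top unfolding gpd_top_def openin_subtopology by (elim exE conjE)
  have "\<Phi> (g, \<xi>) \<in> topspace (gpd_top M2 L2)"
    using Phi_arrows[OF arr] B.topspace_gpd_top by simp
  then have "\<Phi> (g, \<xi>) \<in> W" unfolding W_def v_def gpd_top_def by (auto simp: mem_Times_iff)
  then have "(g, \<xi>) \<in> T" using T(2) arr by blast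
  from T(1)[unfolded openin_prod_topology_alt, rule_format, OF this]
  obtain U V where UV: "openin A.X V" "g \<in> U" "\<xi> \<in> V" "U \<times> V \<subseteq> T"
    by (elim exE conjE) (rule that)
  have "fst (\<Phi> (g, \<eta>)) = v" if "\<eta> \<in> V" "\<eta> \<in> pdom M1 L1 g" for \<eta>
  proof -
    have "(g, \<eta>) \<in> T" using that(1) UV by blast
    moreover have "(g, \<eta>) \<in> gpd_arrows M1 L1" using that(2) g by (simp add: gpd_arrows_def)
    ultimately have "\<Phi> (g, \<eta>) \<in> W" using T(2) by blast
    then show ?thesis by (auto simp: W_def)
  qed
  then show ?thesis using UV(1,3) by (intro exI[of _ V]) (simp add: v_def)
qed

text \<open>Closedness of \<open>pdom\<close> in the compact completion turns local constancy into
  dependence on finitely many coordinates, hence on the point modulo a full subgroup.\<close>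

lemma cocycle_uniform:
  assumes g: "g \<in> grpG M1 L1"
  shows "\<exists>D. full_subgroup D \<and> D \<subseteq> L1 \<and>
    (\<forall>x\<in>dom0 L1 g. \<forall>y\<in>dom0 L1 g. x - y \<in> D \<longrightarrow> cocycle g x = cocycle g y)"
proof -
  have "closedin A.X (pdom M1 L1 g)" by (simp add: pdom_def)
  from A.locally_constant_factors[of _ "\<lambda>\<xi>. fst (\<Phi> (g, \<xi>))", OF this cocycle_locally_constant[OF g], simplified]
  obtain F where F: "finite F" "F \<subseteq> A.\<C>"
    "\<forall>\<xi>\<in>pdom M1 L1 g. \<forall>\<eta>\<in>pdom M1 L1 g. (\<forall>C\<in>F. \<xi> C = \<eta> C) \<longrightarrow> fst (\<Phi> (g, \<xi>)) = fst (\<Phi> (g, \<eta>))"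
    by (elim exE conjE)
  have "full_subgroup (L1 \<inter> \<Inter>F)"
    using F A.constructible_full A.full_L by (intro full_subgroup_INT) auto
  moreover have "cocycle g x = cocycle g y"
    if "x \<in> dom0 L1 g" "y \<in> dom0 L1 g" "x - y \<in> L1 \<inter> \<Inter>F" for x y
  proof -
    have agree: "\<forall>C\<in>F. A.\<iota> x C = A.\<iota> y C" using that(3) F(2) by (simp add: A.iota_eq_iff subset_iff)
    show ?thesis
      unfolding cocycle_def
      by (rule F(3)[rule_format, OF A.iota_pdom[OF that(1)] A.iota_pdom[OF that(2)]], rule bspec[OF agree])
  qed
  ultimately show ?thesis by (intro exI[of _ "L1 \<inter> \<Inter>F"]) simp
qed

text \<open>Finitely many generators of \<open>L1\<close> share a modulus, and by the cocycle
  identity the translations for which it works form a subgroup.\<close>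

lemma translation_cocycle_uniform:
  "\<exists>H. full_subgroup H \<and> H \<subseteq> L1 \<and>
    (\<forall>b\<in>L1. \<forall>x\<in>L1. \<forall>y\<in>L1. x - y \<in> H \<longrightarrow> cocycle (b, 1) x = cocycle (b, 1) y)"
proof -
  obtain S where S: "finite S" "S \<subseteq> L1" "zspan S = L1" using A.fin_gen_L by (auto simp: fin_gen_def)
  have "\<forall>b\<in>S. \<exists>D. full_subgroup D \<and> D \<subseteq> L1 \<and>
      (\<forall>x\<in>L1. \<forall>y\<in>L1. x - y \<in> D \<longrightarrow> cocycle (b, 1) x = cocycle (b, 1) y)"
    using cocycle_uniform[OF A.translation_in_grpG] S(2) A.dom0_translation by (metis subsetD)
  then obtain D where D: "\<And>b. b \<in> S \<Longrightarrow> full_subgroup (D b)"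
    "\<And>b x y. b \<in> S \<Longrightarrow> x \<in> L1 \<Longrightarrow> y \<in> L1 \<Longrightarrow> x - y \<in> D b \<Longrightarrow> cocycle (b, 1) x = cocycle (b, 1) y"
    by metis
  define H where "H = L1 \<inter> \<Inter>(D ` S)"
  have fullH: "full_subgroup H"
    unfolding H_def using S D A.full_L by (intro full_subgroup_INT) auto
  define G where "G = {b \<in> L1. \<forall>x\<in>L1. \<forall>y\<in>L1. x - y \<in> H \<longrightarrow> cocycle (b, 1) x = cocycle (b, 1) y}"
  have "add_subgroup G"
    unfolding add_subgroup_def
  proof (intro conjI ballI)
    show "0 \<in> G" using zero_in_L cocycle_one by (simp add: G_def)
  next
    fix b d assume bd: "b \<in> G" "d \<in> G"
    then have L: "b \<in> L1" "d \<in> L1" by (auto simp: G_def)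
    have "cocycle (b + d, 1) x = cocycle (b + d, 1) y" if xy: "x \<in> L1" "y \<in> L1" "x - y \<in> H" for x y
    proof -
      have "cocycle (d, 1) x = cocycle (d, 1) y" using bd(2) xy by (simp add: G_def)
      moreover have "cocycle (b, 1) (d + x) = cocycle (b, 1) (d + y)"
        using bd(1) xy L(2) add_subgroup_add[OF A.L(1)] by (simp add: G_def)
      ultimately show ?thesis using L xy by (simp add: cocycle_translation_add)
    qed
    then show "b + d \<in> G" using L add_subgroup_add[OF A.L(1)] by (simp add: G_def)
  next
    fix b assume b: "b \<in> G"
    then have L: "b \<in> L1" "- b \<in> L1" using add_subgroup_minus[OF A.L(1)] by (auto simp: G_def)
    \<comment> \<open>The value of \<open>- b\<close> at \<open>x\<close> is inverse to that of
      \<open>b\<close> at \<open>x - b\<close>, so independence of the point modulo \<open>H\<close>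
      carries over.\<close>
    have inverse: "gmult (cocycle (- b, 1) x) (cocycle (b, 1) (x - b)) = (0, 1)" if "x \<in> L1" for x
      using cocycle_translation_add[OF L(2,1), of "x - b"] that L add_subgroup_diff[OF A.L(1)]
      by (simp add: cocycle_one)
    have "cocycle (- b, 1) x = cocycle (- b, 1) y" if xy: "x \<in> L1" "y \<in> L1" "x - y \<in> H" for x y
    proof -
      have mem: "x - b \<in> L1" "y - b \<in> L1" using xy L(1) add_subgroup_diff[OF A.L(1)] by auto
      have "cocycle (b, 1) (x - b) = cocycle (b, 1) (y - b)"
        using b mem xy(3) by (simp add: G_def)
      then have "gmult (cocycle (- b, 1) x) (cocycle (b, 1) (y - b))
          = gmult (cocycle (- b, 1) y) (cocycle (b, 1) (y - b))"
        using inverse xy by metis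
      then show ?thesis
        using L(1) mem(2) A.dom0_translation[OF L(1)]
        by (elim gmult_cancel_right) (auto intro!: qunit_cocycle A.translation_in_grpG)
    qed
    then show "- b \<in> G" using L by (simp add: G_def)
  qed
  moreover have "S \<subseteq> G" using S(2) D(2) by (auto simp: G_def H_def)
  ultimately have "L1 \<subseteq> G" using zspan_minimal S(3) by metis
  then show ?thesis using fullH by (intro exI[of _ H]) (auto simp: G_def H_def)
qed

text \<open>Evaluates \<open>(0, a) (b, 1) = (a b, 1) (0, a)\<close> at \<open>0\<close> in two
  ways; the left side involves \<open>(0, a)\<close> at the point \<open>b\<close>, which
  \<open>const\<close> replaces by \<open>0\<close>.\<close>

lemma cocycle_dilation:
  assumes a: "a \<in> M1" and b: "b \<in> L1" and const: "cocycle (0, a) b = cocycle (0, a) 0"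
  shows "gmult (cocycle (0, a) 0) (cocycle (b, 1) 0) = gmult (cocycle (a * b, 1) 0) (cocycle (0, a) 0)"
proof -
  have ab: "a * b \<in> L1" using A.L(4) a b by blast
  have "gmult (0, a) (b, 1) = gmult (a * b, 1) (0, a)" by (simp add: gmult_def)
  moreover have "cocycle (gmult (0, a) (b, 1)) 0 = gmult (cocycle (0, a) b) (cocycle (b, 1) 0)"
    using cocycle_gmult[of "(0, a)" "(b, 1)" 0] a b zero_in_L
    by (simp add: A.translation_in_grpG A.dilation_in_grpG A.dom0_translation A.dom0_dilation act_def)
  moreover have "cocycle (gmult (a * b, 1) (0, a)) 0 = gmult (cocycle (a * b, 1) 0) (cocycle (0, a) 0)"
    using cocycle_gmult[of "(a * b, 1)" "(0, a)" 0] a ab zero_in_L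
    by (simp add: A.translation_in_grpG A.dilation_in_grpG A.dom0_translation A.dom0_dilation act_def)
  ultimately show ?thesis using const by metis
qed

text \<open>Conjugation does not change linear parts, as these commute.\<close>

lemma snd_cocycle_dilation:
  assumes "a \<in> M1" "b \<in> L1" "cocycle (0, a) b = cocycle (0, a) 0"
  shows "snd (cocycle (a * b, 1) 0) = snd (cocycle (b, 1) 0)"
proof -
  have "snd (cocycle (0, a) 0) * snd (cocycle (a * b, 1) 0) = snd (cocycle (0, a) 0) * snd (cocycle (b, 1) 0)"
    using arg_cong[OF cocycle_dilation[OF assms], of snd] B.mult_commute by (simp add: gmult_def)
  moreover have "qunit (snd (cocycle (0, a) 0))"
    using assms(1) zero_in_L A.dom0_dilation by (intro qunit_cocycle A.dilation_in_grpG) auto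
  ultimately show ?thesis using qunit_cancel by blast
qed

section \<open>Linear equivariant embedding\<close>

theorem equivariant_embedding:
  "\<exists>\<alpha>::'a \<Rightarrow> 'b. (\<forall>x y. \<alpha> (x + y) = \<alpha> x + \<alpha> y) \<and> (\<forall>x. \<alpha> x = 0 \<longrightarrow> x = 0)
    \<and> (\<forall>u\<in>M1. \<exists>\<tau>\<in>grp_gen M2. \<forall>x. \<alpha> (u * x) = \<tau> * \<alpha> x)"
proof -
  obtain H where H: "full_subgroup H" "H \<subseteq> L1"
    "\<And>b x y. b \<in> L1 \<Longrightarrow> x \<in> L1 \<Longrightarrow> y \<in> L1 \<Longrightarrow> x - y \<in> H \<Longrightarrow> cocycle (b, 1) x = cocycle (b, 1) y"
    using translation_cocycle_uniform by blast
  have subH: "add_subgroup H" using H(1) by (simp add: full_subgroup_def)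
  define \<rho> where "\<rho> b = cocycle (b, 1) 0" for b
  \<comment> \<open>The second summand has to lie in \<open>H\<close>, because the outer value is
    moved from the point \<open>d\<close> to \<open>0\<close>.\<close>
  have \<rho>_add: "\<rho> (b + d) = gmult (\<rho> b) (\<rho> d)" if "b \<in> L1" "d \<in> H" for b d
    using cocycle_translation_add[of b d 0] H(3)[of b d 0] that H(2) zero_in_L
    by (auto simp: \<rho>_def)
  have \<rho>_zero: "\<rho> 0 = (0, 1)" using cocycle_one[OF zero_in_L] by (simp add: \<rho>_def)
  have dilation: "\<exists>D. full_subgroup D \<and> D \<subseteq> L1 \<and> (\<forall>b\<in>D. cocycle (0, a) b = cocycle (0, a) 0)"
    if a: "a \<in> M1" for a
  proof -
    obtain D where D: "full_subgroup D" "D \<subseteq> L1"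
      "\<forall>x\<in>L1. \<forall>y\<in>L1. x - y \<in> D \<longrightarrow> cocycle (0, a) x = cocycle (0, a) y"
      using cocycle_uniform[OF A.dilation_in_grpG[OF a]] A.dom0_dilation[OF a] by auto
    have "cocycle (0, a) b = cocycle (0, a) 0" if "b \<in> D" for b
      using that D zero_in_L by auto
    then show ?thesis using D by blast
  qed
  \<comment> \<open>On \<open>N\<close> the values of \<open>\<rho>\<close> are translations, so
    their first component is additive.\<close>
  define N where "N = {b \<in> H. snd (\<rho> b) = 1}"
  have subN: "add_subgroup N"
    unfolding add_subgroup_def
  proof (intro conjI ballI)
    show "0 \<in> N" using add_subgroup_zero[OF subH] \<rho>_zero by (simp add: N_def)
    show "b + d \<in> N" if "b \<in> N" "d \<in> N" for b d
      using that \<rho>_add[of b d] H(2) add_subgroup_add[OF subH] by (auto simp: N_def gmult_def)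
    show "- b \<in> N" if "b \<in> N" for b
      using that \<rho>_add[of "- b" b] \<rho>_zero H(2) add_subgroup_minus[OF subH, of b]
      by (auto simp: N_def gmult_def)
  qed
  have fullN: "full_subgroup N"
    unfolding full_subgroup_def
  proof (intro conjI allI subN)
    fix x
    \<comment> \<open>With \<open>x = (1 - a) z\<close>, a multiple of \<open>x\<close> has the form
      \<open>d - a d\<close>, and \<open>\<rho> d\<close> and \<open>\<rho> (a d)\<close> have equal
      linear parts.\<close>
    obtain a where a: "a \<in> M1" "qunit (1 - a)" using A.qunit_one_minus by blast
    obtain D where D: "full_subgroup D" "D \<subseteq> L1" "\<forall>b\<in>D. cocycle (0, a) b = cocycle (0, a) 0"
      using dilation[OF a(1)] by blast
    define z where "z = qinv (1 - a) * x"
    have x: "(1 - a) * z = x"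
      using qinv_right[OF a(2)] by (simp add: z_def mult.assoc[symmetric])
    \<comment> \<open>One \<open>n\<close> treats \<open>z\<close> and \<open>a * z\<close>
      together, since \<open>H\<close> and \<open>D\<close> are not known to be stable under
      \<open>a\<close>.\<close>
    obtain n where n: "n > 0" "of_nat n * z \<in> H \<inter> D" "of_nat n * (a * z) \<in> H \<inter> D"
      using full_subgroup_common_multiple[OF full_subgroup_Int[OF H(1) D(1)], of "{z, a * z}"] by auto
    define d where "d = of_nat n * z"
    have ad: "a * d = of_nat n * (a * z)" by (simp add: d_def A.mult_left_commute)
    have mem: "d \<in> H" "d \<in> D" "a * d \<in> H" using n unfolding ad by (simp_all add: d_def)
    have eq: "of_nat n * x = d - a * d"
      unfolding x[symmetric] d_def by (simp add: left_diff_distrib right_diff_distrib A.mult_left_commute)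
    have diff: "d - a * d \<in> H" using mem by (intro add_subgroup_diff[OF subH])
    have "\<rho> d = gmult (\<rho> (d - a * d)) (\<rho> (a * d))"
      using \<rho>_add[of "d - a * d" "a * d"] diff mem(3) H(2) by auto
    moreover have "snd (\<rho> (a * d)) = snd (\<rho> d)"
      unfolding \<rho>_def using mem D(2,3) by (intro snd_cocycle_dilation a(1)) auto
    ultimately have "snd (\<rho> d) * snd (\<rho> (d - a * d)) = snd (\<rho> d) * 1"
      using B.mult_commute by (metis gmult_def mult_1_right snd_conv)
    moreover have "qunit (snd (\<rho> d))"
      unfolding \<rho>_def using mem(1) H(2) zero_in_L A.dom0_translation
      by (intro qunit_cocycle A.translation_in_grpG) auto
    ultimately have "snd (\<rho> (d - a * d)) = 1" using qunit_cancel by blast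
    then show "\<exists>n::nat. n > 0 \<and> of_nat n * x \<in> N"
      using n(1) diff eq by (intro exI[of _ n]) (simp add: N_def)
  qed
  have \<rho>_fst: "fst (\<rho> (b + d)) = fst (\<rho> b) + fst (\<rho> d)" if "b \<in> N" "d \<in> N" for b d
    using that \<rho>_add[of b d] H(2) by (auto simp: N_def gmult_def)
  have "\<exists>\<alpha>. (\<forall>x y. \<alpha> (x + y) = \<alpha> x + \<alpha> y) \<and> (\<forall>b\<in>N. \<alpha> b = fst (\<rho> b))"
    using fullN \<rho>_fst by (rule B.extend_additive)
  then obtain \<alpha> where \<alpha>': "\<forall>x y. \<alpha> (x + y) = \<alpha> x + \<alpha> y" "\<forall>b\<in>N. \<alpha> b = fst (\<rho> b)"
    by (elim exE conjE)
  note \<alpha> = \<alpha>'[rule_format]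
  have \<alpha>n: "\<alpha> (of_nat n * x) = of_nat n * \<alpha> x" for n x using \<alpha>(1) by (rule additive_of_nat)
  have "x = 0" if "\<alpha> x = 0" for x
  proof -
    obtain n where n: "n > 0" "of_nat n * x \<in> N" using full_subgroup_multiple[OF fullN] .
    then have "fst (\<rho> (of_nat n * x)) = 0" using \<alpha>(2)[OF n(2)] \<alpha>n that by simp
    then have "\<rho> (of_nat n * x) = (0, 1)" using n(2) by (simp add: N_def prod_eq_iff)
    then have "of_nat n * x = 0"
      using cocycle_translation_trivial[of "of_nat n * x"] n(2) H(2) by (auto simp: \<rho>_def N_def)
    then show ?thesis using A.torsion_free[OF n(1)] by blast
  qed
  moreover have "\<exists>\<tau>\<in>grp_gen M2. \<forall>x. \<alpha> (u * x) = \<tau> * \<alpha> x" if u: "u \<in> M1" for u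
  proof -
    obtain D where D: "full_subgroup D" "D \<subseteq> L1" "\<forall>b\<in>D. cocycle (0, u) b = cocycle (0, u) 0"
      using dilation[OF u] by blast
    \<comment> \<open>The linear part of the value at the dilation by \<open>u\<close> is the
      multiplier \<open>\<tau>\<close>.\<close>
    define k where "k = cocycle (0, u) 0"
    have k: "snd k \<in> grp_gen M2"
      using cocycle_grpG[of "(0, u)" 0] A.dilation_in_grpG[OF u] A.dom0_dilation[OF u] zero_in_L
      by (auto simp: k_def grpG_def)
    have "\<alpha> (u * x) = snd k * \<alpha> x" for x
    proof -
      obtain n where n: "n > 0" "of_nat n * x \<in> N \<inter> D" "of_nat n * (u * x) \<in> N \<inter> D"
        using full_subgroup_common_multiple[OF full_subgroup_Int[OF fullN D(1)], of "{x, u * x}"] by auto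
      define b where "b = of_nat n * x"
      have ub: "u * b = of_nat n * (u * x)" by (simp add: b_def A.mult_left_commute)
      have mem: "b \<in> N" "b \<in> D" "u * b \<in> N" using n unfolding ub by (simp_all add: b_def)
      have "gmult k (\<rho> b) = gmult (\<rho> (u * b)) k"
        unfolding k_def \<rho>_def using mem(2) D(2,3) by (intro cocycle_dilation u) auto
      \<comment> \<open>Comparison of translation parts: \<open>\<rho> (u * b)\<close> has linear
        part \<open>1\<close>, so the translation part of \<open>k\<close> appears on both sides and
        cancels.\<close>
      then have "snd k * fst (\<rho> b) = fst (\<rho> (u * b))"
        using mem(3) by (simp add: gmult_def N_def)
      then have "\<alpha> (u * b) = snd k * \<alpha> b" using mem \<alpha>(2) by simp
      then have "of_nat n * \<alpha> (u * x) = snd k * (of_nat n * \<alpha> x)"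
        unfolding ub unfolding b_def \<alpha>n .
      then have "of_nat n * \<alpha> (u * x) = of_nat n * (snd k * \<alpha> x)"
        by (simp only: B.mult_left_commute)
      then show ?thesis using B.of_nat_cancel[OF n(1)] by blast
    qed
    then show ?thesis using k by blast
  qed
  ultimately show ?thesis using \<alpha>(1) by (intro exI[of _ \<alpha>] conjI) simp_all
qed

end

section \<open>From an equivariant embedding to an algebra isomorphism\<close>

lemma zintegral_image:
  assumes "qalg_iso \<phi>" "zintegral x"
  shows "zintegral (\<phi> x)"
proof -
  have \<phi>: "\<And>x y. \<phi> (x + y) = \<phi> x + \<phi> y" "\<And>x y. \<phi> (x * y) = \<phi> x * \<phi> y" "\<phi> 1 = 1"
    using assms(1) by (auto simp: qalg_iso_def)
  have pow: "\<phi> (x ^ n) = \<phi> x ^ n" for n by (induction n) (simp_all add: \<phi>)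
  obtain n c where "x ^ n + (\<Sum>i<n. of_int (c i) * x ^ i) = 0" using assms(2) by (auto simp: zintegral_def)
  then have "\<phi> (x ^ n + (\<Sum>i<n. of_int (c i) * x ^ i)) = 0" using \<phi>(1)[of 0 0] by simp
  then have "\<phi> x ^ n + (\<Sum>i<n. of_int (c i) * \<phi> x ^ i) = 0"
    by (simp add: \<phi>(1) additive_sum[of \<phi>, OF \<phi>(1)] additive_of_int[of \<phi>, OF \<phi>(1)] pow)
  then show ?thesis unfolding zintegral_def by (intro exI[of _ n] exI[of _ c])
qed

section \<open>Ranks and normalisation of the embedding\<close>

locale lattice_action_pair =
  A: lattice_action R1 M1 L1 + B: lattice_action R2 M2 L2
  for R1 M1 L1 :: "'a::ring_1 set" and R2 M2 L2 :: "'b::ring_1 set"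
begin

text \<open>Serves both the rank inequality and surjectivity.\<close>

lemma embedding_basis:
  fixes \<alpha> :: "'a \<Rightarrow> 'b"
  assumes "\<And>x y. \<alpha> (x + y) = \<alpha> x + \<alpha> y" "\<forall>x. \<alpha> x = 0 \<longrightarrow> x = 0"
  shows "\<exists>S. finite S \<and> zindep (\<alpha> ` S) \<and> card (\<alpha> ` S) = zrank R1"
proof -
  obtain S where S: "finite S" "S \<subseteq> L1" "zindep S" "card S = zrank R1"
    using A.zrank_attained by (elim exE conjE)
  have "inj_on \<alpha> S"
    by (rule zindep_image(1)[of \<alpha> S, OF assms(1) _ S(3)]) (rule assms(2)[rule_format])
  moreover have "zindep (\<alpha> ` S)"
    by (rule zindep_image(2)[of \<alpha> S, OF assms(1) _ S(3)]) (rule assms(2)[rule_format])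
  ultimately show ?thesis using S by (intro exI[of _ S]) (simp add: card_image)
qed

lemma zrank_le_of_embedding:
  fixes \<alpha> :: "'a \<Rightarrow> 'b"
  assumes "\<And>x y. \<alpha> (x + y) = \<alpha> x + \<alpha> y" "\<forall>x. \<alpha> x = 0 \<longrightarrow> x = 0"
  shows "zrank R1 \<le> zrank R2"
proof -
  obtain S where "finite S" "zindep (\<alpha> ` S)" "card (\<alpha> ` S) = zrank R1"
    using embedding_basis[OF assms] by (elim exE conjE)
  then show ?thesis using B.card_zindep_le[of "\<alpha> ` S"] by simp
qed

text \<open>The rank bound makes \<open>\<alpha>\<close> bijective. Equivariance makes every value a
  multiple of \<open>w = \<alpha> 1\<close>, so \<open>w\<close> is a unit, and
  \<open>\<alpha>\<close> divided by \<open>w\<close> is multiplicative.\<close>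

lemma algebra_iso_of_embedding:
  fixes \<alpha> :: "'a \<Rightarrow> 'b"
  assumes add: "\<And>x y. \<alpha> (x + y) = \<alpha> x + \<alpha> y" and ker: "\<forall>x. \<alpha> x = 0 \<longrightarrow> x = 0"
    and equiv: "\<forall>u\<in>M1. \<exists>\<tau>\<in>grp_gen M2. \<forall>x. \<alpha> (u * x) = \<tau> * \<alpha> x"
    and rank: "zrank R2 \<le> zrank R1"
  shows "\<exists>\<phi>::'a \<Rightarrow> 'b. qalg_iso \<phi> \<and> \<phi> ` M1 \<subseteq> Mtilde M2"
proof -
  have \<alpha>n: "\<alpha> (of_nat n * x) = of_nat n * \<alpha> x" for n x using add by (rule additive_of_nat)
  have \<alpha>0: "\<alpha> 0 = 0" using add[of 0 0] by simp
  have \<alpha>m: "\<alpha> (- x) = - \<alpha> x" for x using add[of x "- x"] \<alpha>0 by (simp add: eq_neg_iff_add_eq_0 add.commute)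
  have inj: "inj \<alpha>"
  proof (rule injI)
    fix x y assume "\<alpha> x = \<alpha> y"
    then have "\<alpha> (x - y) = 0" using add[of "x - y" y] by simp
    then show "x = y" using ker by force
  qed
  have surj: "\<exists>x. y = \<alpha> x" for y
  proof -
    obtain S where S: "finite S" "zindep (\<alpha> ` S)" "card (\<alpha> ` S) = zrank R1"
      using embedding_basis[OF add ker] by (elim exE conjE)
    \<comment> \<open>By \<open>rank\<close> the image of \<open>S\<close> is large enough to span
      up to integer multiples; divisibility then gives surjectivity.\<close>
    then have "full_subgroup (zspan (\<alpha> ` S))" using rank by (intro B.max_zindep_full) auto
    then obtain n where n: "n > 0" "of_nat n * y \<in> zspan (\<alpha> ` S)" by (rule full_subgroup_multiple)
    have "add_subgroup (range \<alpha>)"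
      using range_eqI[of 0 \<alpha> 0] \<alpha>0
      unfolding add_subgroup_def by (auto simp: add[symmetric] \<alpha>m[symmetric])
    then have "zspan (\<alpha> ` S) \<subseteq> range \<alpha>" by (intro zspan_minimal) auto
    then obtain x where x: "of_nat n * y = \<alpha> x" using n(2) by auto
    obtain x' where "of_nat n * x' = x" using A.of_nat_divide[OF n(1)] by blast
    then have "y = \<alpha> x'" using x \<alpha>n B.of_nat_cancel[OF n(1)] by metis
    then show ?thesis by blast
  qed
  define w where "w = \<alpha> 1"
  \<comment> \<open>On \<open>M1\<close> this is equivariance at \<open>1\<close>; it extends to
    \<open>zspan M1\<close> by addition and to all \<open>x\<close> by division.\<close>
  have factor: "\<exists>z. \<alpha> x = z * w" for x
  proof -
    have "add_subgroup {x. \<exists>z. \<alpha> x = z * w}"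
      unfolding add_subgroup_def
    proof (intro conjI ballI; (elim CollectE exE)?; intro CollectI)
      show "\<exists>z. \<alpha> 0 = z * w" using \<alpha>0 by (intro exI[of _ 0]) simp
      show "\<exists>z. \<alpha> (- x) = z * w" if "\<alpha> x = z * w" for x z
        using that \<alpha>m by (intro exI[of _ "- z"]) simp
      show "\<exists>z. \<alpha> (x + x') = z * w" if "\<alpha> x = z * w" "\<alpha> x' = z' * w" for x x' z z'
        using that add by (intro exI[of _ "z + z'"]) (simp add: distrib_right)
    qed
    moreover have "M1 \<subseteq> {x. \<exists>z. \<alpha> x = z * w}"
    proof
      fix u assume "u \<in> M1"
      then obtain \<tau> where "\<And>x. \<alpha> (u * x) = \<tau> * \<alpha> x" using equiv by blast
      from this[of 1] show "u \<in> {x. \<exists>z. \<alpha> x = z * w}" by (auto simp: w_def)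
    qed
    ultimately have sub: "zspan M1 \<subseteq> {x. \<exists>z. \<alpha> x = z * w}" by (rule zspan_minimal)
    obtain n where n: "n > 0" "of_nat n * x \<in> zspan M1" by (rule full_subgroup_multiple[OF A.full_zspan_M])
    then obtain z where z: "of_nat n * \<alpha> x = z * w" using sub \<alpha>n by auto
    obtain z' where "of_nat n * z' = z" using B.of_nat_divide[OF n(1)] by blast
    then have "of_nat n * \<alpha> x = of_nat n * (z' * w)" using z by (metis mult.assoc)
    then show ?thesis using B.of_nat_cancel[OF n(1)] by blast
  qed
  \<comment> \<open>By surjectivity \<open>1\<close> is a value of \<open>\<alpha>\<close>, hence a
    multiple of \<open>w\<close>.\<close>
  obtain v where "1 = v * w" using surj[of 1] factor by metis
  then have v: "v * w = 1" "w * v = 1" using B.mult_commute by metis+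
  define \<phi> where "\<phi> x = \<alpha> x * v" for x
  have \<phi>_add: "\<phi> (x + y) = \<phi> x + \<phi> y" for x y by (simp add: \<phi>_def add distrib_right)
  have \<phi>n: "\<phi> (of_nat n * x) = of_nat n * \<phi> x" for n x by (simp add: \<phi>_def \<alpha>n mult.assoc)
  have \<phi>0: "\<phi> 0 = 0" and \<phi>m: "\<phi> (- x) = - \<phi> x" for x by (simp_all add: \<phi>_def \<alpha>0 \<alpha>m)
  have \<phi>_equiv: "\<phi> u \<in> grp_gen M2" "\<phi> (u * x) = \<phi> u * \<phi> x" if "u \<in> M1" for u x
  proof -
    obtain \<tau> where \<tau>: "\<tau> \<in> grp_gen M2" "\<And>x. \<alpha> (u * x) = \<tau> * \<alpha> x" using equiv \<open>u \<in> M1\<close> by blast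
    have "\<phi> u = \<tau>" using \<tau>(2)[of 1] v by (simp add: \<phi>_def w_def mult.assoc)
    then show "\<phi> u \<in> grp_gen M2" "\<phi> (u * x) = \<phi> u * \<phi> x"
      using \<tau> by (simp_all add: \<phi>_def mult.assoc)
  qed
  \<comment> \<open>Multiplicativity in \<open>y\<close> holds on \<open>M1\<close> and is an
    additive condition, so it spreads to \<open>zspan M1\<close>.\<close>
  have "add_subgroup {y. \<forall>x. \<phi> (y * x) = \<phi> y * \<phi> x}"
    unfolding add_subgroup_def by (simp add: \<phi>0 \<phi>m \<phi>_add distrib_right)
  then have mult_M: "zspan M1 \<subseteq> {y. \<forall>x. \<phi> (y * x) = \<phi> y * \<phi> x}"
    using \<phi>_equiv(2) by (intro zspan_minimal) auto
  have \<phi>_mult: "\<phi> (y * x) = \<phi> y * \<phi> x" for x y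
  proof -
    obtain n where n: "n > 0" "of_nat n * y \<in> zspan M1" by (rule full_subgroup_multiple[OF A.full_zspan_M])
    then have "\<phi> (of_nat n * y * x) = \<phi> (of_nat n * y) * \<phi> x" using mult_M by blast
    then have "of_nat n * \<phi> (y * x) = of_nat n * (\<phi> y * \<phi> x)" by (simp add: mult.assoc \<phi>n)
    then show ?thesis using B.of_nat_cancel[OF n(1)] by blast
  qed
  have "bij \<phi>"
  proof (rule bijI)
    show "inj \<phi>"
    proof (rule injI)
      fix x y assume "\<phi> x = \<phi> y"
      then have "\<alpha> x * v * w = \<alpha> y * v * w" by (simp add: \<phi>_def)
      then show "x = y" using v(1) inj by (simp add: mult.assoc inj_eq)
    qed
    show "surj \<phi>"
      unfolding surj_def
    proof
      fix y
      obtain x where "y * w = \<alpha> x" using surj by blast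
      then have "y = \<phi> x" using v(2) by (metis \<phi>_def mult.assoc mult_1_right)
      then show "\<exists>x. y = \<phi> x" by blast
    qed
  qed
  then have iso: "qalg_iso \<phi>"
    using v(2) by (simp add: qalg_iso_def \<phi>_add \<phi>_mult) (simp add: \<phi>_def w_def)
  \<comment> \<open>\<open>u\<close> is integral because it lies in the finitely generated ring
    \<open>R1\<close>, and ring isomorphisms preserve integrality.\<close>
  moreover have "zintegral (\<phi> u)" if "u \<in> M1" for u
    using zintegral_of_fin_gen[OF A.R(1,2)] A.M_subset that by (intro zintegral_image[OF iso]) auto
  ultimately show ?thesis using \<phi>_equiv(1) by (intro exI[of _ \<phi>]) (auto simp: Mtilde_def)
qed

end

section \<open>Both directions of the groupoid isomorphism\<close>

theorem theorem5p3:
  fixes R1 M1 L1 :: "'a::ring_1 set" and R2 M2 L2 :: "'b::ring_1 set"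
  assumes R1: "unital_subring R1" "fin_gen R1" "is_QR R1"
      and M1: "abelian_submonoid_regular R1 M1" "finite_index (zspan M1) R1"
      and L1: "add_subgroup L1" "L1 \<subseteq> R1" "zrank L1 = zrank R1" "\<forall>a\<in>M1. \<forall>x\<in>L1. a * x \<in> L1"
      and inj1: "\<exists>a\<in>M1. inj_on (\<lambda>x. (1 - a) * x) L1"
      and R2: "unital_subring R2" "fin_gen R2" "is_QR R2"
      and M2: "abelian_submonoid_regular R2 M2" "finite_index (zspan M2) R2"
      and L2: "add_subgroup L2" "L2 \<subseteq> R2" "zrank L2 = zrank R2" "\<forall>a\<in>M2. \<forall>x\<in>L2. a * x \<in> L2"
      and inj2: "\<exists>a\<in>M2. inj_on (\<lambda>x. (1 - a) * x) L2"
      and iso: "groupoids_iso M1 L1 M2 L2"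
  shows "\<exists>(\<phi>1::'a \<Rightarrow> 'b) (\<phi>2::'b \<Rightarrow> 'a). qalg_iso \<phi>1 \<and> qalg_iso \<phi>2 \<and>
           \<phi>1 ` M1 \<subseteq> Mtilde M2 \<and> \<phi>2 ` M2 \<subseteq> Mtilde M1"
proof -
  interpret A: lattice_action R1 M1 L1 using R1 M1 L1 inj1 by unfold_locales
  interpret B: lattice_action R2 M2 L2 using R2 M2 L2 inj2 by unfold_locales
  interpret AB: lattice_action_pair R1 M1 L1 R2 M2 L2 by unfold_locales
  interpret BA: lattice_action_pair R2 M2 L2 R1 M1 L1 by unfold_locales
  let ?A1 = "gpd_arrows M1 L1" and ?A2 = "gpd_arrows M2 L2"
  obtain \<Phi> where bij: "bij_betw \<Phi> ?A1 ?A2"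
    and homeo: "homeomorphic_map (gpd_top M1 L1) (gpd_top M2 L2) \<Phi>"
    and comp: "\<And>\<gamma> \<delta>. \<gamma> \<in> ?A1 \<Longrightarrow> \<delta> \<in> ?A1 \<Longrightarrow>
      (gpd_src \<gamma> = gpd_rng M1 L1 \<delta> \<longleftrightarrow> gpd_src (\<Phi> \<gamma>) = gpd_rng M2 L2 (\<Phi> \<delta>)) \<and>
      (gpd_src \<gamma> = gpd_rng M1 L1 \<delta> \<longrightarrow> \<Phi> (gpd_comp \<gamma> \<delta>) = gpd_comp (\<Phi> \<gamma>) (\<Phi> \<delta>))"
    using iso unfolding groupoids_iso_def top_gpd_iso_def by (elim exE conjE) blast
  interpret F: action_morphism R1 M1 L1 R2 M2 L2 \<Phi>
  proof unfold_locales
    show "inj_on \<Phi> ?A1" "\<And>\<gamma>. \<gamma> \<in> ?A1 \<Longrightarrow> \<Phi> \<gamma> \<in> ?A2"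
      using bij by (auto simp: bij_betw_def)
    show "continuous_map (gpd_top M1 L1) (gpd_top M2 L2) \<Phi>"
      using homeo by (rule homeomorphic_imp_continuous_map)
  qed (use comp in blast)
  obtain \<Psi> where \<Psi>: "homeomorphic_maps (gpd_top M1 L1) (gpd_top M2 L2) \<Phi> \<Psi>"
    using homeo unfolding homeomorphic_map_maps by blast
  then have \<Psi>\<Phi>: "\<And>\<gamma>. \<gamma> \<in> ?A1 \<Longrightarrow> \<Psi> (\<Phi> \<gamma>) = \<gamma>" and \<Phi>\<Psi>: "\<And>\<gamma>. \<gamma> \<in> ?A2 \<Longrightarrow> \<Phi> (\<Psi> \<gamma>) = \<gamma>"
    and cont: "continuous_map (gpd_top M2 L2) (gpd_top M1 L1) \<Psi>"
    unfolding homeomorphic_maps_def by (auto simp: A.topspace_gpd_top B.topspace_gpd_top)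
  have arr: "\<Psi> \<gamma> \<in> ?A1" if "\<gamma> \<in> ?A2" for \<gamma>
    using continuous_map_image_subset_topspace[OF cont] that
    by (auto simp: A.topspace_gpd_top B.topspace_gpd_top)
  interpret G: action_morphism R2 M2 L2 R1 M1 L1 \<Psi>
  proof unfold_locales
    show "inj_on \<Psi> ?A2" using \<Phi>\<Psi> by (metis inj_onI)
    fix \<gamma> \<delta> assume *: "\<gamma> \<in> ?A2" "\<delta> \<in> ?A2" "gpd_src \<gamma> = gpd_rng M2 L2 \<delta>"
    \<comment> \<open>The equivalence in \<open>comp\<close> reflects composability, so the
      preimages are composable.\<close>
    then have src: "gpd_src (\<Psi> \<gamma>) = gpd_rng M1 L1 (\<Psi> \<delta>)"
      using comp[of "\<Psi> \<gamma>" "\<Psi> \<delta>"] arr \<Phi>\<Psi> by simp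
    then have "\<Phi> (gpd_comp (\<Psi> \<gamma>) (\<Psi> \<delta>)) = gpd_comp \<gamma> \<delta>"
      using comp[of "\<Psi> \<gamma>" "\<Psi> \<delta>"] arr \<Phi>\<Psi> * by simp
    \<comment> \<open>\<open>\<Psi>\<close> is known to undo \<open>\<Phi>\<close> on arrows, so the
      composite of the preimages must be an arrow.\<close>
    then show "\<Psi> (gpd_comp \<gamma> \<delta>) = gpd_comp (\<Psi> \<gamma>) (\<Psi> \<delta>)"
      using \<Psi>\<Phi>[OF A.gpd_comp_closed[OF arr[OF *(1)] arr[OF *(2)] src]] by simp
  qed (use arr cont in auto)
  obtain \<alpha> where \<alpha>: "\<forall>x y. \<alpha> (x + y) = \<alpha> x + \<alpha> y" "\<forall>x. \<alpha> x = 0 \<longrightarrow> x = 0"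
    "\<forall>u\<in>M1. \<exists>\<tau>\<in>grp_gen M2. \<forall>x. \<alpha> (u * x) = \<tau> * \<alpha> x"
    using F.equivariant_embedding by (elim exE conjE)
  obtain \<beta> where \<beta>: "\<forall>x y. \<beta> (x + y) = \<beta> x + \<beta> y" "\<forall>x. \<beta> x = 0 \<longrightarrow> x = 0"
    "\<forall>u\<in>M2. \<exists>\<tau>\<in>grp_gen M1. \<forall>x. \<beta> (u * x) = \<tau> * \<beta> x"
    using G.equivariant_embedding by (elim exE conjE)
  \<comment> \<open>The rank bound for each direction comes from the embedding in the other
    direction.\<close>
  have "\<exists>\<phi>::'a \<Rightarrow> 'b. qalg_iso \<phi> \<and> \<phi> ` M1 \<subseteq> Mtilde M2"
    by (rule AB.algebra_iso_of_embedding[OF \<alpha>(1)[rule_format] \<alpha>(2,3) BA.zrank_le_of_embedding[OF \<beta>(1)[rule_format] \<beta>(2)]])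
  moreover have "\<exists>\<phi>::'b \<Rightarrow> 'a. qalg_iso \<phi> \<and> \<phi> ` M2 \<subseteq> Mtilde M1"
    by (rule BA.algebra_iso_of_embedding[OF \<beta>(1)[rule_format] \<beta>(2,3) AB.zrank_le_of_embedding[OF \<alpha>(1)[rule_format] \<alpha>(2)]])
  ultimately show ?thesis by blast
qed

end
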